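(* Let $K$ be a field and let $I$ be a matroidal ideal of degree $d$ of the polynomial ring $R=K[x_1,\dots,x_n]$ with $\mathrm{supp}(I)=\{x_1,\dots,x_n\}$, and let $h$ be the height of $I$. Then $\mathrm{ara}\,I=q(I)+1$ if one of the following holds: (i) $I$ is square-free Veronese; (ii) $I=J_1J_2\cdots J_d$ such that each $J_i$ is generated by $h$ distinct variables; (iii) $d=2$.
   Context: $R=K[x_1,\dots,x_n]$ is the polynomial ring in $n\ge 1$ variables over a field $K$, with each $\deg x_i=1$. For a monomial $u=x_1^{a_1}\cdots x_n^{a_n}$, $\mathrm{supp}(u)=\{x_i : a_i\neq 0\}$. For a monomial ideal $I$, $G(I)$ is its unique minimal set of monomial generators and $\mathrm{supp}(I)=\bigcup_{u\in G(I)}\mathrm{supp}(u)$. A monomial ideal $I$ is matroidal if every member of $G(I)$ is square-free and the following exchange condition holds: for any $u=x_1^{a_1}\cdots x_n^{a_n}$, $v=x_1^{b_1}\cdots x_n^{b_n}$ in $G(I)$, if $a_i>b_i$ for some $i$, then there is some $j$ with $a_j<b_j$ such that $x_ju/x_i\in G(I)$. All elements of $G(I)$ then have the same degree $d$, called the degree of $I$. The square-free Veronese ideal of degree $d$ in $\{x_1,\dots,x_n\}$ is the ideal generated by all square-free monomials of degree $d$ in these variables; "$I$ is square-free Veronese" means that $I$ is this ideal. A monomial ideal $I$ has linear quotients if there is an ordering $u_1,\dots,u_s$ of the monomials of $G(I)$ with $\deg u_1\le\cdots\le\deg u_s$ such that for each $2\le j\le s$ the colon ideal $\langle u_1,\dots,u_{j-1}\rangle:u_j$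 is generated by a subset of $\{x_1,\dots,x_n\}$. For such an ordering, $q_j(I)$ is the number of variables required to generate $\langle u_1,\dots,u_{j-1}\rangle:u_j$, and $q(I)=\max\{q_j(I) : 2\le j\le s\}$ (with $q(I)=0$ if $s=1$). It is known that $q(I)$ does not depend on the choice of such an ordering, and that every matroidal ideal has linear quotients. The arithmetical rank $\mathrm{ara}\,I$ of an ideal $I$ of $R$ is the minimal number $m$ such that there are $f_1,\dots,f_m\in R$ with $\sqrt{(f_1,\dots,f_m)}=\sqrt{I}$. *)

theory Defs
  imports Complex_Main "HOL-Library.Poly_Mapping" "HOL-Library.Extended_Nat"
begin

section \<open>Ideals of a commutative ring\<close>

text \<open>An ideal of a commutative ring is a subspace of the ring regarded as a module over
  itself, and the ideal generated by a set is its span.\<close>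

interpretation ring_module: module "(*) :: 'a::comm_ring_1 \<Rightarrow> 'a \<Rightarrow> 'a"
  by unfold_locales (simp_all add: algebra_simps)

abbreviation is_ideal :: "'a::comm_ring_1 set \<Rightarrow> bool"
  where "is_ideal \<equiv> module.subspace (*)"

abbreviation ideal_gen :: "'a::comm_ring_1 set \<Rightarrow> 'a set"
  where "ideal_gen \<equiv> module.span (*)"

definition prime_ideal :: "'a::comm_ring_1 set \<Rightarrow> bool"
  where "prime_ideal P \<longleftrightarrow>
    is_ideal P \<and> P \<noteq> UNIV \<and> (\<forall>a b. a * b \<in> P \<longrightarrow> a \<in> P \<or> b \<in> P)"

definition prime_height :: "'a::comm_ring_1 set \<Rightarrow> enat"
  where "prime_height P = (SUP k \<in> {k. \<exists>Q :: nat \<Rightarrow> 'a set.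
      (\<forall>i\<le>k. prime_ideal (Q i)) \<and> (\<forall>i<k. Q i \<subset> Q (Suc i)) \<and> Q k = P}. enat k)"

definition ideal_height :: "'a::comm_ring_1 set \<Rightarrow> enat"
  where "ideal_height I = (INF P \<in> {P. prime_ideal P \<and> I \<subseteq> P}. prime_height P)"

definition ideal_radical :: "'a::comm_ring_1 set \<Rightarrow> 'a set"
  where "ideal_radical I = {f. \<exists>k::nat. f ^ k \<in> I}"

definition ideal_colon :: "'a::comm_ring_1 set \<Rightarrow> 'a \<Rightarrow> 'a set"
  where "ideal_colon I g = {f. f * g \<in> I}"

definition ideal_product :: "nat \<Rightarrow> (nat \<Rightarrow> 'a::comm_ring_1 set) \<Rightarrow> 'a set"
  where "ideal_product d J = ideal_gen {(\<Prod>i\<in>{1..d}. f i) | f. \<forall>i\<in>{1..d}. f i \<in> J i}"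

text \<open>In a Noetherian ring the set of admissible \<open>m\<close> is nonempty; the family
  \<open>f\<close> may have repetitions.\<close>

definition ara :: "'a::comm_ring_1 set \<Rightarrow> nat"
  where "ara I = (LEAST m. \<exists>f :: nat \<Rightarrow> 'a.
      ideal_radical (ideal_gen (f ` {1..m})) = ideal_radical I)"

section \<open>Monomial ideals\<close>

text \<open>The polynomial ring in \<open>n = CARD('n)\<close> variables over \<open>'k\<close> is the type
  \<open>('n, 'k) mpol\<close>; its variables are indexed by the elements of \<open>'n\<close>. A monomial is
  represented by its exponent vector, so that the product of monomials is \<open>+\<close>, their
  quotient (when it exists) is \<open>-\<close>, the support is \<open>keys\<close>, and
  \<open>single i 1\<close> is the variable with index \<open>i\<close>.\<close>

type_synonym 'n mon = "'n \<Rightarrow>\<^sub>0 nat"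
type_synonym ('n, 'k) mpol = "('n \<Rightarrow>\<^sub>0 nat) \<Rightarrow>\<^sub>0 'k"

abbreviation mono_poly :: "'n mon \<Rightarrow> ('n, 'k::field) mpol"
  where "mono_poly u \<equiv> Poly_Mapping.single u 1"

abbreviation var_poly :: "'n \<Rightarrow> ('n, 'k::field) mpol"
  where "var_poly i \<equiv> mono_poly (Poly_Mapping.single i 1)"

definition mon_deg :: "'n::finite mon \<Rightarrow> nat"
  where "mon_deg u = (\<Sum>i\<in>UNIV. Poly_Mapping.lookup u i)"

definition squarefree_mon :: "'n mon \<Rightarrow> bool"
  where "squarefree_mon u \<longleftrightarrow> (\<forall>i. Poly_Mapping.lookup u i \<le> 1)"

definition monomial_ideal :: "('n, 'k::field) mpol set \<Rightarrow> bool"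
  where "monomial_ideal I \<longleftrightarrow> (\<exists>S. I = ideal_gen (mono_poly ` S))"

definition is_min_gens :: "('n, 'k::field) mpol set \<Rightarrow> 'n mon set \<Rightarrow> bool"
  where "is_min_gens I G \<longleftrightarrow> ideal_gen (mono_poly ` G) = I \<and>
    (\<forall>H. H \<subset> G \<longrightarrow> ideal_gen (mono_poly ` H) \<noteq> I)"

definition min_gens :: "('n, 'k::field) mpol set \<Rightarrow> 'n mon set"
  where "min_gens I = (THE G. is_min_gens I G)"

definition ideal_supp :: "('n, 'k::field) mpol set \<Rightarrow> 'n set"
  where "ideal_supp I = (\<Union>u\<in>min_gens I. Poly_Mapping.keys u)"

lemma keys_mono_poly_ideal:
  fixes f :: "('n, 'k::field) mpol"
  assumes "f \<in> ideal_gen (mono_poly ` S)" "u \<in> Poly_Mapping.keys f"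
  shows "\<exists>v\<in>S. \<exists>w. u = w + v"
  using assms
proof (induction arbitrary: u rule: ring_module.span_induct_alt)
  case base
  then show ?case by simp
next
  case (step c x y)
  obtain v where v: "v \<in> S" "x = mono_poly v" using step by auto
  consider "u \<in> Poly_Mapping.keys (c * x)" | "u \<in> Poly_Mapping.keys y"
    using step.prems Poly_Mapping.keys_add[of "c * x" y] by blast
  then show ?case
  proof cases
    case 1
    then show ?thesis using keys_mult[of c x] v by (simp add: v(2)) blast
  next
    case 2
    then show ?thesis using step.IH by blast
  qed
qed

lemma mono_poly_in_ideal_iff:
  "mono_poly u \<in> (ideal_gen (mono_poly ` S) :: ('n, 'k::field) mpol set)
    \<longleftrightarrow> (\<exists>v\<in>S. \<exists>w. u = w + v)"
proof
  assume "mono_poly u \<in> (ideal_gen (mono_poly ` S) :: ('n, 'k) mpol set)"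
  then show "\<exists>v\<in>S. \<exists>w. u = w + v"
    by (rule keys_mono_poly_ideal) simp
next
  assume "\<exists>v\<in>S. \<exists>w. u = w + v"
  then obtain v w where vw: "v \<in> S" "u = w + v" by blast
  have "mono_poly w * mono_poly v \<in> (ideal_gen (mono_poly ` S) :: ('n, 'k) mpol set)"
    using vw(1) by (intro ring_module.span_scale ring_module.span_base) auto
  then show "mono_poly u \<in> (ideal_gen (mono_poly ` S) :: ('n, 'k) mpol set)"
    by (simp add: mult_single vw(2))
qed

lemma ex1_min_gens:
  fixes I :: "('n::finite, 'k::field) mpol set"
  assumes "monomial_ideal I"
  shows "\<exists>!G. is_min_gens I G"
proof -
  obtain S where S: "I = ideal_gen (mono_poly ` S)"
    using assms by (auto simp: monomial_ideal_def)
  define M where "M = {u. mono_poly u \<in> I \<and> (\<forall>v w. mono_poly v \<in> I \<longrightarrow> u = w + v \<longrightarrow> u = v)}"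
  have sub: "M \<subseteq> H" if H: "I = ideal_gen (mono_poly ` H)" for H
  proof
    fix u assume u: "u \<in> M"
    then obtain v w where vw: "v \<in> H" "u = w + v"
      by (auto simp: M_def H mono_poly_in_ideal_iff)
    have "mono_poly v \<in> I" unfolding H using vw(1) by (intro ring_module.span_base) auto
    then show "u \<in> H" using u vw by (auto simp: M_def)
  qed
  have div: "\<exists>v\<in>M. \<exists>w. u = w + v" if "mono_poly u \<in> I" for u
    using that
  proof (induction "mon_deg u" arbitrary: u rule: less_induct)
    case less
    show ?case
    proof (cases "u \<in> M")
      case True
      then show ?thesis by (metis add_0)
    next
      case False
      then obtain v w where vw: "mono_poly v \<in> I" "u = w + v" "u \<noteq> v"
        using less.prems by (auto simp: M_def)
      have "w \<noteq> 0" using vw by auto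
      then obtain i where "Poly_Mapping.lookup w i \<noteq> 0"
        by (metis poly_mapping_eqI lookup_zero)
      then have "mon_deg w > 0"
        unfolding mon_deg_def by (intro sum_pos2[of _ i]) auto
      then have "mon_deg v < mon_deg u"
        by (simp add: vw(2) mon_deg_def lookup_add sum.distrib)
      with less.hyps vw(1) obtain v' w' where "v' \<in> M" "v = w' + v'" by blast
      then show ?thesis using vw(2) by (metis add.assoc)
    qed
  qed
  have gen: "ideal_gen (mono_poly ` M) = I"
  proof
    have "mono_poly ` M \<subseteq> I" by (auto simp: M_def)
    then show "ideal_gen (mono_poly ` M) \<subseteq> I"
      unfolding S by (metis ring_module.span_mono ring_module.span_span)
    have "mono_poly ` S \<subseteq> (ideal_gen (mono_poly ` M) :: ('n, 'k) mpol set)"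
    proof safe
      fix u assume "u \<in> S"
      then have "mono_poly u \<in> I" unfolding S by (intro ring_module.span_base) auto
      then show "mono_poly u \<in> (ideal_gen (mono_poly ` M) :: ('n, 'k) mpol set)"
        using div by (simp add: mono_poly_in_ideal_iff)
    qed
    then show "I \<subseteq> ideal_gen (mono_poly ` M)"
      unfolding S by (metis ring_module.span_mono ring_module.span_span)
  qed
  show ?thesis
  proof (rule ex1I[of _ M])
    show "is_min_gens I M"
      unfolding is_min_gens_def using gen sub by blast
    show "G = M" if "is_min_gens I G" for G
      using that sub[of G] gen unfolding is_min_gens_def by blast
  qed
qed

section \<open>Matroidal ideals and linear quotients\<close>

definition matroidal :: "('n, 'k::field) mpol set \<Rightarrow> bool"
  where "matroidal I \<longleftrightarrow> monomial_ideal I \<and> (\<forall>u\<in>min_gens I. squarefree_mon u) \<and>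
    (\<forall>u\<in>min_gens I. \<forall>v\<in>min_gens I. \<forall>i. Poly_Mapping.lookup u i > Poly_Mapping.lookup v i \<longrightarrow>
      (\<exists>j. Poly_Mapping.lookup u j < Poly_Mapping.lookup v j \<and>
        Poly_Mapping.single j 1 + u - Poly_Mapping.single i 1 \<in> min_gens I))"

definition has_degree :: "('n::finite, 'k::field) mpol set \<Rightarrow> nat \<Rightarrow> bool"
  where "has_degree I d \<longleftrightarrow> (\<forall>u\<in>min_gens I. mon_deg u = d)"

definition squarefree_veronese :: "nat \<Rightarrow> ('n::finite, 'k::field) mpol set"
  where "squarefree_veronese d = ideal_gen (mono_poly ` {u. squarefree_mon u \<and> mon_deg u = d})"

text \<open>Lists are indexed from 0, so the colon ideal of \<open>us ! j\<close> is taken for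
  \<open>1 \<le> j < length us\<close>.\<close>

definition lq_colon :: "'n mon list \<Rightarrow> nat \<Rightarrow> ('n, 'k::field) mpol set"
  where "lq_colon us j =
    ideal_colon (ideal_gen (mono_poly ` set (take j us))) (mono_poly (us ! j))"

definition linear_quotient_ordering ::
    "('n::finite, 'k::field) mpol set \<Rightarrow> 'n mon list \<Rightarrow> bool"
  where "linear_quotient_ordering I us \<longleftrightarrow>
    distinct us \<and> set us = min_gens I \<and> sorted (map mon_deg us) \<and>
    (\<forall>j\<in>{1..<length us}. \<exists>V. (lq_colon us j :: ('n, 'k) mpol set) = ideal_gen (var_poly ` V))"

definition num_gen_vars :: "('n::finite, 'k::field) mpol set \<Rightarrow> nat"
  where "num_gen_vars L = (LEAST m. \<exists>V. card V = m \<and> L = ideal_gen (var_poly ` V))"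

definition q_ordering :: "('n::finite, 'k::field) mpol set \<Rightarrow> 'n mon list \<Rightarrow> nat"
  where "q_ordering I us =
    Max (insert 0 ((\<lambda>j. num_gen_vars (lq_colon us j :: ('n, 'k) mpol set)) ` {1..<length us}))"

text \<open>The value common to all linear quotient orderings of \<open>I\<close>. The ideal argument of
  \<open>q_ordering\<close> only fixes the coefficient field.\<close>

definition q_inv :: "('n::finite, 'k::field) mpol set \<Rightarrow> nat"
  where "q_inv I = (THE q. \<exists>us. linear_quotient_ordering I us \<and> q = q_ordering I us)"

end

theory Submission
  imports Defs "HOL-Library.Cardinality" "HOL-Library.Nat_Bijection"
begin

text \<open>Both sides equal \<open>n - d + 1\<close>, where \<open>n\<close> is the number of variables. The supports of
the monomials in \<open>G(I)\<close> are the bases of a matroid of rank \<open>d\<close> on the variables, which has no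
loops because every variable divides a generator. Write \<open>x\<^sub>B\<close> for the square-free monomial with
support \<open>B\<close>.

The number \<open>q(I)\<close>: a variable lies in the colon ideal of \<open>x\<^sub>B\<close> by other generators only if it is
outside \<open>B\<close>, so at most \<open>n - d\<close> variables are needed at each step. At the last basis \<open>B\<close> of an
ordering all of them occur, because for every \<open>i \<notin> B\<close> some exchange \<open>B - b + i\<close> is a basis
(\<open>q_ordering_eq\<close>). A lexicographic ordering of the bases has linear quotients
(\<open>linear_quotient_ordering_exists\<close>).

The upper bound: let \<open>g\<^sub>k\<close> be the sum of all square-free monomials of degree \<open>k\<close> in \<open>I\<close>, for
\<open>k = d, ..., n\<close>. Two different ones of the same degree have a product divisible by a square-free
monomial of \<open>I\<close> of higher degree. By descending induction on \<open>k\<close>, as in the lemma of Schmitt and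
Vogel, all these monomials lie in the radical of the ideal generated by the \<open>g\<^sub>k\<close>
(\<open>radical_generators_upper_bound\<close>).

The lower bound is the vanishing of local cohomology beyond the number of generators, set against the
nonvanishing of the local cohomology of \<open>R\<close> with support in \<open>I\<close> in degree \<open>n - d + 1\<close>, in
elementary form. Let \<open>\<Delta>\<close> be the set of all \<open>T\<close> that are disjoint from some basis, which is the
independence complex of the dual matroid; its facets, the complements of the bases, have \<open>n - d\<close>
elements. For a set \<open>T\<close> of variables let \<open>M\<^sub>T\<close> consist of functions on the exponent vectors \<open>a\<close>
with \<open>a\<^sub>i < 0\<close> for all \<open>i \<in> T\<close>, on which \<open>R\<close> acts by shifting exponents. Restricting from \<open>M\<^sub>T\<close>
to \<open>M\<^sub>T\<^sub>+\<^sub>i\<close>, with signs, gives a complex that is exact in positive degrees when \<open>T\<close> ranges over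
all sets. If \<open>T \<in> \<Delta>\<close> misses the basis \<open>B\<close>, then \<open>x\<^sub>B\<close> acts invertibly on \<open>M\<^sub>T\<close>; if \<open>T \<notin> \<Delta>\<close>,
then every element of \<open>M\<^sub>T\<close> that is bounded below is killed by a power of \<open>I\<close>. Suppose that \<open>f\<^sub>1, ..., f\<^sub>m\<close> generate \<open>I\<close> up to radical.
Combine the complex over \<open>T \<in> \<Delta>\<close> with the Koszul complexes of the powers \<open>f\<^sub>1\<^sup>t, ..., f\<^sub>m\<^sup>t\<close>. The
Koszul direction is exact by invertibility (\<open>koszul_exact\<close>), and the other direction is
exact after multiplication by powers of the \<open>f\<^sub>j\<close> (\<open>simplicial_exact\<close>). If \<open>m \<le> n - d\<close>, a zigzag
through the double complex shows that every top-degree cochain on \<open>\<Delta>\<close> is a coboundary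
(\<open>top_cochain_is_coboundary\<close>).

That is impossible, because \<open>\<Delta>\<close> carries a nonzero top-degree cycle. Colour each variable by a basis
element so that every transversal of the colour classes is a basis (\<open>transversal_coloring\<close>); the
classes are the successive differences in a complete flag of flats. The complements of the transversals,
with suitable signs, form the cycle (\<open>transversal_complements_carry_cycle\<close>).\<close>

section \<open>Bases of a loopless matroid\<close>

locale loopless_matroid =
  fixes \<B> :: "'n::finite set set" and d :: nat
  assumes card_basis: "B \<in> \<B> \<Longrightarrow> card B = d"
    and exchange: "\<lbrakk>X \<in> \<B>; Y \<in> \<B>; i \<in> X; i \<notin> Y\<rbrakk>
      \<Longrightarrow> \<exists>j. j \<in> Y \<and> j \<notin> X \<and> insert j (X - {i}) \<in> \<B>"
    and loopless: "\<Union>\<B> = UNIV"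
begin

lemma basis_exists: "\<exists>B. B \<in> \<B>"
  using loopless by blast

text \<open>Among the bases that contain \<open>A\<close>, one with as few elements as possible outside \<open>A \<union> Y\<close> has
none there: exchanging such an element against \<open>Y\<close> would lower their number.\<close>

lemma augment:
  assumes "X \<in> \<B>" "Y \<in> \<B>" "A \<subseteq> X"
  shows "\<exists>Z\<in>\<B>. A \<subseteq> Z \<and> Z \<subseteq> A \<union> Y"
  using assms(1,3)
proof (induction "card (X - (A \<union> Y))" arbitrary: X rule: less_induct)
  case less
  show ?case
  proof (cases "X \<subseteq> A \<union> Y")
    case True
    then show ?thesis using less.prems by blast
  next
    case False
    then obtain z where z: "z \<in> X" "z \<notin> A" "z \<notin> Y" by blast
    then obtain j where j: "j \<in> Y" "j \<notin> X" "insert j (X - {z}) \<in> \<B>"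
      using exchange[OF less.prems(1) assms(2)] by blast
    have "card (insert j (X - {z}) - (A \<union> Y)) < card (X - (A \<union> Y))"
      by (rule psubset_card_mono) (use z j in auto)
    then show ?thesis using less.hyps[of "insert j (X - {z})"] j z less.prems(2) by blast
  qed
qed

lemma basis_subset_eq: "B \<in> \<B> \<Longrightarrow> B' \<in> \<B> \<Longrightarrow> B \<subseteq> B' \<Longrightarrow> B = B'"
  using card_basis by (metis card_subset_eq finite)

lemma basis_eq_swap:
  assumes "B \<in> \<B>" "Z \<in> \<B>" "Z \<subseteq> insert i B" "i \<notin> B" "i \<in> Z"
  shows "\<exists>b\<in>B. b \<notin> Z \<and> Z = insert i (B - {b})"
proof -
  obtain b where b: "b \<in> B" "b \<notin> Z"
    using basis_subset_eq[of B Z] assms by blast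
  have "Z \<subseteq> insert i (B - {b})" using assms b by blast
  moreover have "card (insert i (B - {b})) = card Z"
    using assms b by (metis card_Suc_Diff1 card_basis card_insert_disjoint finite insert_Diff_single
        insert_iff Diff_iff)
  ultimately show ?thesis using b by (metis card_subset_eq finite)
qed

text \<open>The dual exchange property, where the entering element is prescribed. A basis between
\<open>insert i (X \<inter> Y)\<close> and \<open>insert i (X \<inter> Y) \<union> Y\<close> can only be \<open>Y\<close> with \<open>i\<close> swapped in, and the
element that leaves is not in \<open>X\<close> because \<open>X \<inter> Y\<close> is kept.\<close>

lemma exchange_into:
  assumes "X \<in> \<B>" "Y \<in> \<B>" "i \<in> X" "i \<notin> Y"
  shows "\<exists>b\<in>Y. b \<notin> X \<and> insert i (Y - {b}) \<in> \<B>"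
proof -
  obtain Z where Z: "Z \<in> \<B>" "insert i (X \<inter> Y) \<subseteq> Z" "Z \<subseteq> insert i (X \<inter> Y) \<union> Y"
    using augment[of X Y "insert i (X \<inter> Y)"] assms by blast
  then obtain b where "b \<in> Y" "b \<notin> Z" "Z = insert i (Y - {b})"
    using basis_eq_swap[of Y Z i] assms by blast
  then show ?thesis using Z by blast
qed

lemma insert_element:
  assumes "Y \<in> \<B>" "i \<notin> Y"
  shows "\<exists>b\<in>Y. insert i (Y - {b}) \<in> \<B>"
  using exchange_into[OF _ assms(1) _ assms(2)] loopless by blast

text \<open>In terms of circuits: the hypothesis \<open>no_swap\<close> says that the fundamental circuit of \<open>c\<close> with
respect to \<open>X\<close> lies in \<open>insert c A\<close>, and then it is also the fundamental circuit of \<open>c\<close> with respect to any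
basis \<open>Y\<close> containing \<open>A\<close>. The proof extends \<open>insert c (A - {b})\<close> into \<open>Y\<close>; if \<open>b\<close> survives,
then \<open>insert c A\<close> is independent, and extending it into \<open>X\<close> gives a forbidden swap.\<close>

lemma transfer_swap:
  assumes "X \<in> \<B>" "Y \<in> \<B>" "A \<subseteq> X" "A \<subseteq> Y" "b \<in> A" "c \<notin> X" "c \<notin> Y"
    and swap: "insert c (X - {b}) \<in> \<B>"
    and no_swap: "\<And>x. x \<in> X - A \<Longrightarrow> insert c (X - {x}) \<notin> \<B>"
  shows "insert c (Y - {b}) \<in> \<B>"
proof -
  obtain Z where Z: "Z \<in> \<B>" "insert c (A - {b}) \<subseteq> Z" "Z \<subseteq> insert c (A - {b}) \<union> Y"
    using augment[OF swap assms(2), of "insert c (A - {b})"] assms by blast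
  obtain y where y: "y \<in> Y" "y \<notin> Z" "Z = insert c (Y - {y})"
    using basis_eq_swap[of Y Z c] assms Z by blast
  show ?thesis
  proof (cases "y = b")
    case True
    then show ?thesis using y Z by simp
  next
    case False
    then have "insert c A \<subseteq> Z" using y Z assms by blast
    then obtain W where W: "W \<in> \<B>" "insert c A \<subseteq> W" "W \<subseteq> insert c A \<union> X"
      using augment[OF Z(1) assms(1)] by blast
    then obtain x where "x \<in> X" "x \<notin> W" "W = insert c (X - {x})"
      using basis_eq_swap[of X W c] assms by blast
    then show ?thesis using no_swap[of x] W by blast
  qed
qed

text \<open>Fix a basis \<open>B0\<close>, ordered by \<open>e\<close>, and colour \<open>i\<close> by the last element of \<open>B0\<close> in its fundamental
circuit. The elements with colours up to \<open>b\<close> form the flat spanned by the elements of \<open>B0\<close> up to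
\<open>b\<close>, so the colour classes are the successive differences of a complete flag of flats. A transversal
\<open>C\<close> arises from \<open>B0\<close> by replacing its elements one by one, the last one first: the circuit that
justifies a replacement lies in the initial segment of \<open>B0\<close> not yet touched, and
\<open>transfer_swap\<close> applies.\<close>

lemma transversal_coloring:
  fixes e :: "'n \<Rightarrow> nat"
  assumes e: "inj e"
  shows "\<exists>B0\<in>\<B>. \<exists>\<beta>. (\<forall>b\<in>B0. \<beta> b = b) \<and> range \<beta> = B0 \<and>
    (\<forall>C. bij_betw \<beta> C B0 \<longrightarrow> C \<in> \<B>)"
proof -
  obtain B0 where B0: "B0 \<in> \<B>" using basis_exists by blast
  have "\<exists>b. b \<in> B0 \<and> (i \<in> B0 \<longrightarrow> b = i) \<and> (i \<notin> B0 \<longrightarrow> insert i (B0 - {b}) \<in> \<B> \<and>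
      (\<forall>x\<in>B0. insert i (B0 - {x}) \<in> \<B> \<longrightarrow> e x \<le> e b))" for i
  proof (cases "i \<in> B0")
    case False
    let ?S = "{b\<in>B0. insert i (B0 - {b}) \<in> \<B>}"
    have "?S \<noteq> {}" using insert_element[OF B0 False] by blast
    then have "Max (e ` ?S) \<in> e ` ?S" by (intro Max_in) auto
    then obtain b where b: "Max (e ` ?S) = e b" "b \<in> ?S" by (rule imageE)
    have "e x \<le> e b" if "x \<in> ?S" for x
      unfolding b(1)[symmetric] using that by (intro Max_ge) auto
    then have "\<forall>x\<in>B0. insert i (B0 - {x}) \<in> \<B> \<longrightarrow> e x \<le> e b" by blast
    then show ?thesis using b(2) False by (intro exI[of _ b]) simp
  next
    case True
    then show ?thesis by (intro exI[of _ i]) simp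
  qed
  then obtain \<beta> where \<beta>0: "\<And>i. \<beta> i \<in> B0 \<and> (i \<in> B0 \<longrightarrow> \<beta> i = i) \<and>
      (i \<notin> B0 \<longrightarrow> insert i (B0 - {\<beta> i}) \<in> \<B> \<and>
        (\<forall>x\<in>B0. insert i (B0 - {x}) \<in> \<B> \<longrightarrow> e x \<le> e (\<beta> i)))"
    by (rule that[OF someI_ex])
  then have \<beta>: "\<And>i. \<beta> i \<in> B0" "\<And>i. i \<in> B0 \<Longrightarrow> \<beta> i = i"
      "\<And>i. i \<notin> B0 \<Longrightarrow> insert i (B0 - {\<beta> i}) \<in> \<B>"
      "\<And>i x. i \<notin> B0 \<Longrightarrow> x \<in> B0 \<Longrightarrow> insert i (B0 - {x}) \<in> \<B> \<Longrightarrow> e x \<le> e (\<beta> i)"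
    by (simp_all only:) simp_all
  have "C \<in> \<B>" if C: "bij_betw \<beta> C B0" for C
  proof -
    \<comment> \<open>Interpolates between \<open>B0\<close> for large \<open>k\<close> and \<open>C\<close> for \<open>k = 0\<close>.\<close>
    define H where "H k = {b\<in>B0. e b < k} \<union> {c\<in>C. k \<le> e (\<beta> c)}" for k
    have injC: "inj_on \<beta> C" and imC: "\<beta> ` C = B0" using C by (auto simp: bij_betw_def)
    obtain M where M: "\<And>i. e i < M"
      using finite_nat_set_iff_bounded[of "range e"] by auto
    have step: "H k \<in> \<B>" if IH: "H (Suc k) \<in> \<B>" for k
    proof (cases "\<exists>b\<in>B0. e b = k")
      case False
      then have "e b < k \<longleftrightarrow> e b < Suc k" "k \<le> e b \<longleftrightarrow> Suc k \<le> e b" if "b \<in> B0" for b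
        using that by (metis less_Suc_eq, metis Suc_le_eq le_less)
      then have "H k = H (Suc k)" unfolding H_def using \<beta>(1) by blast
      then show ?thesis using IH by simp
    next
      case True
      then obtain b where b: "b \<in> B0" "e b = k" by blast
      obtain c where c: "c \<in> C" "\<beta> c = b" using imC b by blast
      have eb: "e x = k \<longleftrightarrow> x = b" for x using b e by (auto dest: injD)
      have cc: "x = c" if "x \<in> C" "\<beta> x = b" for x
        using injC c that by (metis inj_onD)
      have Hk: "H k = insert c (H (Suc k) - {b})"
      proof (intro set_eqI iffI)
        fix x assume "x \<in> H k"
        then consider "x \<in> B0" "e x < k" | "x \<in> C" "k \<le> e (\<beta> x)" by (auto simp: H_def)
        then show "x \<in> insert c (H (Suc k) - {b})"
        proof cases
          case 1
          then show ?thesis using b by (auto simp: H_def)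
        next
          case 2
          show ?thesis
          proof (cases "e (\<beta> x) = k")
            case True
            then show ?thesis using cc 2 eb by blast
          next
            case False
            then have "x \<noteq> b" using b \<beta>(2) by auto
            then show ?thesis using 2 False by (auto simp: H_def)
          qed
        qed
      next
        fix x assume "x \<in> insert c (H (Suc k) - {b})"
        then consider "x = c" | "x \<in> B0" "e x < Suc k" "x \<noteq> b" | "x \<in> C" "Suc k \<le> e (\<beta> x)"
          by (auto simp: H_def)
        then show "x \<in> H k"
        proof cases
          case 2
          then show ?thesis using eb[of x] by (simp add: H_def less_Suc_eq)
        qed (use b c in \<open>simp_all add: H_def\<close>)
      qed
      show ?thesis
      proof (cases "c \<in> B0")
        case True
        then have "c = b" using \<beta>(2) c by auto
        moreover have "b \<in> H (Suc k)" using b by (auto simp: H_def)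
        ultimately show ?thesis using Hk IH by (simp add: insert_absorb)
      next
        case False
        have cH: "c \<notin> H (Suc k)" using False c b by (auto simp: H_def)
        show ?thesis unfolding Hk
        proof (rule transfer_swap[of B0 _ "{x\<in>B0. e x \<le> k}"])
          show "insert c (B0 - {b}) \<in> \<B>" using \<beta>(3)[OF False] c by simp
          show "insert c (B0 - {x}) \<notin> \<B>" if "x \<in> B0 - {x \<in> B0. e x \<le> k}" for x
            using \<beta>(4)[OF False, of x] that c b by auto
        qed (use B0 IH b False cH in \<open>auto simp: H_def\<close>)
      qed
    qed
    have "H M = B0" using M by (simp add: H_def not_le[symmetric])
    then have "H M \<in> \<B>" using B0 by simp
    then have "H 0 \<in> \<B>"
    proof (induction M)
      case (Suc M)
      then show ?case using step by blast
    qed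
    then show ?thesis by (simp add: H_def)
  qed
  moreover have "range \<beta> = B0" 
  proof
    show "range \<beta> \<subseteq> B0" using \<beta>(1) by blast
    show "B0 \<subseteq> range \<beta>" using \<beta>(2) by (metis rangeI subsetI)
  qed
  ultimately show ?thesis using B0 \<beta>(2) by blast
qed

end

section \<open>Signed coboundaries\<close>

definition sgn_in :: "('i \<Rightarrow> nat) \<Rightarrow> 'i \<Rightarrow> 'i set \<Rightarrow> 'k::comm_ring_1"
  where "sgn_in e i S = (- 1) ^ card {j\<in>S. e j < e i}"

text \<open>The coboundary of cochains on the finite subsets of \<open>'i\<close>, with an operator \<open>\<phi> i\<close> attached to the
inclusion of \<open>S - {i}\<close> in \<open>S\<close>. For \<open>\<phi> i\<close> the identity it is the simplicial coboundary; for
\<open>\<phi> i\<close> the multiplication by a ring element it is the differential of a Koszul complex. The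
position function \<open>e\<close> orders the index set and so fixes the signs.\<close>

definition coboundary :: "('i \<Rightarrow> nat) \<Rightarrow> ('i \<Rightarrow> ('x \<Rightarrow> 'k) \<Rightarrow> ('x \<Rightarrow> 'k)) \<Rightarrow>
    ('i set \<Rightarrow> 'x \<Rightarrow> 'k) \<Rightarrow> 'i set \<Rightarrow> 'x \<Rightarrow> 'k::comm_ring_1"
  where "coboundary e \<phi> c S = (\<lambda>x. \<Sum>i\<in>S. sgn_in e i S * \<phi> i (c (S - {i})) x)"

definition contraction :: "('i \<Rightarrow> nat) \<Rightarrow> 'i \<Rightarrow> ('i set \<Rightarrow> 'x \<Rightarrow> 'k) \<Rightarrow> 'i set \<Rightarrow> 'x \<Rightarrow> 'k::comm_ring_1"
  where "contraction e i c S = (\<lambda>x. if i \<in> S then 0 else sgn_in e i S * c (insert i S) x)"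

definition linear_op :: "(('x \<Rightarrow> 'k::comm_ring_1) \<Rightarrow> ('y \<Rightarrow> 'k)) \<Rightarrow> bool"
  where "linear_op \<phi> \<longleftrightarrow>
    (\<forall>v w. \<phi> (\<lambda>x. v x + w x) = (\<lambda>y. \<phi> v y + \<phi> w y)) \<and> (\<forall>r v. \<phi> (\<lambda>x. r * v x) = (\<lambda>y. r * \<phi> v y))"

lemma linear_op_add: "linear_op \<phi> \<Longrightarrow> \<phi> (\<lambda>x. v x + w x) = (\<lambda>y. \<phi> v y + \<phi> w y)"
  and linear_op_scale: "linear_op \<phi> \<Longrightarrow> \<phi> (\<lambda>x. r * v x) = (\<lambda>y. r * \<phi> v y)"
  by (simp_all add: linear_op_def)

lemma linear_op_zero: "linear_op \<phi> \<Longrightarrow> \<phi> (\<lambda>x. 0) = (\<lambda>y. 0)"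
  using linear_op_scale[of \<phi> 0 "\<lambda>x. 0"] by simp

lemma linear_op_sum:
  assumes "linear_op \<phi>"
  shows "\<phi> (\<lambda>x. \<Sum>i\<in>A. r i * v i x) = (\<lambda>y. \<Sum>i\<in>A. r i * \<phi> (v i) y)"
proof (induction A rule: infinite_finite_induct)
  case (insert a A)
  then show ?case
    using linear_op_add[OF assms, of "\<lambda>x. r a * v a x"] linear_op_scale[OF assms]
    by simp
qed (simp_all add: linear_op_zero[OF assms])

lemma sgn_in_insert: "sgn_in e i (insert i S) = (sgn_in e i S :: 'a::comm_ring_1)"
proof -
  have "{j \<in> insert i S. e j < e i} = {j \<in> S. e j < e i}" by auto
  then show ?thesis by (simp add: sgn_in_def)
qed

lemma sgn_in_square: "sgn_in e i S * sgn_in e i S = (1::'k::comm_ring_1)"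
  by (simp add: sgn_in_def flip: power_add)

lemma sgn_in_remove_greater:
  assumes "e i < e j"
  shows "sgn_in e i (S - {j}) = sgn_in e i S"
proof -
  have "{x \<in> S - {j}. e x < e i} = {x \<in> S. e x < e i}" using assms by auto
  then show ?thesis by (simp add: sgn_in_def)
qed

lemma sgn_in_remove_less:
  assumes "finite S" "i \<in> S" "e i < e j"
  shows "sgn_in e j (S - {i}) = - (sgn_in e j S :: 'k::comm_ring_1)"
proof -
  have "{x \<in> S. e x < e j} = insert i {x \<in> S - {i}. e x < e j}" using assms by auto
  moreover have "finite {x \<in> S - {i}. e x < e j}" using assms by auto
  ultimately show ?thesis by (simp add: sgn_in_def)
qed

lemma sgn_in_swap:
  assumes "finite S" "inj e" "i \<in> S" "j \<in> S" "i \<noteq> j"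
  shows "sgn_in e i S * sgn_in e j (S - {i}) = - (sgn_in e j S * sgn_in e i (S - {j}) :: 'k::comm_ring_1)"
proof -
  have "e i \<noteq> e j" using assms by (metis injD)
  then consider "e i < e j" | "e j < e i" by linarith
  then show ?thesis
    by cases (simp_all add: sgn_in_remove_greater sgn_in_remove_less assms)
qed

text \<open>Proved by induction, since from \<open>s = - s\<close> nothing follows in
characteristic two.\<close>

lemma sum_antisymmetric_off_diagonal:
  fixes g :: "'i \<Rightarrow> 'i \<Rightarrow> 'k::comm_ring_1"
  assumes "finite S" "\<And>i j. i \<in> S \<Longrightarrow> j \<in> S \<Longrightarrow> i \<noteq> j \<Longrightarrow> g i j = - g j i"
  shows "(\<Sum>i\<in>S. \<Sum>j\<in>S - {i}. g i j) = 0"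
  using assms
proof (induction S rule: finite_induct)
  case (insert a S)
  have "(\<Sum>i\<in>S. \<Sum>j\<in>insert a S - {i}. g i j) = (\<Sum>i\<in>S. g i a + (\<Sum>j\<in>S - {i}. g i j))"
  proof (rule sum.cong)
    fix i assume "i \<in> S"
    then have "insert a S - {i} = insert a (S - {i})" "a \<notin> S - {i}" using insert.hyps by auto
    then show "(\<Sum>j\<in>insert a S - {i}. g i j) = g i a + (\<Sum>j\<in>S - {i}. g i j)"
      using insert.hyps by simp
  qed simp
  also have "(\<Sum>i\<in>S. g i a + (\<Sum>j\<in>S - {i}. g i j)) = (\<Sum>i\<in>S. g i a) + (\<Sum>i\<in>S. \<Sum>j\<in>S - {i}. g i j)"
    by (rule sum.distrib)
  also have "(\<Sum>i\<in>S. \<Sum>j\<in>S - {i}. g i j) = 0"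
    by (rule insert.IH) (rule insert.prems, auto)
  also have "(\<Sum>i\<in>S. g i a) + 0 = (\<Sum>i\<in>S. g i a)" by simp
  also have "\<dots> = - (\<Sum>i\<in>S. g a i)"
    unfolding sum_negf[symmetric]
  proof (rule sum.cong)
    show "g i a = - g a i" if "i \<in> S" for i
      using that insert.hyps by (intro insert.prems) auto
  qed simp
  moreover have "insert a S - {a} = S" using insert.hyps by auto
  ultimately show ?case using insert.hyps by simp
qed simp

lemma coboundary_coboundary:
  fixes c :: "'i set \<Rightarrow> 'x \<Rightarrow> 'k::comm_ring_1"
  assumes "finite S" "inj e" "\<And>i. linear_op (\<phi> i)" "\<And>i j v. \<phi> i (\<phi> j v) = \<phi> j (\<phi> i v)"
  shows "coboundary e \<phi> (coboundary e \<phi> c) S = (\<lambda>x. 0)"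
proof
  fix x
  have "coboundary e \<phi> (coboundary e \<phi> c) S x = (\<Sum>i\<in>S. sgn_in e i S *
      (\<Sum>j\<in>S - {i}. sgn_in e j (S - {i}) * \<phi> i (\<phi> j (c (S - {i} - {j}))) x))"
    unfolding coboundary_def by (simp add: linear_op_sum[OF assms(3)])
  also have "\<dots> = (\<Sum>i\<in>S. \<Sum>j\<in>S - {i}. sgn_in e i S * sgn_in e j (S - {i}) *
      \<phi> i (\<phi> j (c (S - {i} - {j}))) x)"
    by (simp only: sum_distrib_left mult.assoc)
  also have "\<dots> = 0"
  proof (rule sum_antisymmetric_off_diagonal)
    fix i j assume ij: "i \<in> S" "j \<in> S" "i \<noteq> j"
    have eq: "S - {i} - {j} = S - {j} - {i}" by auto
    show "sgn_in e i S * sgn_in e j (S - {i}) * \<phi> i (\<phi> j (c (S - {i} - {j}))) x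
        = - (sgn_in e j S * sgn_in e i (S - {j}) * \<phi> j (\<phi> i (c (S - {j} - {i}))) x)"
      unfolding sgn_in_swap[OF assms(1,2) ij] eq assms(4)[of i j] by simp
  qed (rule assms)
  finally show "coboundary e \<phi> (coboundary e \<phi> c) S x = 0" .
qed

text \<open>Contracting by the index \<open>i\<close> is a homotopy between \<open>\<phi> i\<close> and zero; this is the source of all
exactness below.\<close>

lemma coboundary_contraction:
  fixes c :: "'i set \<Rightarrow> 'x \<Rightarrow> 'k::comm_ring_1"
  assumes "finite S" "inj e" "\<And>i. linear_op (\<phi> i)"
  shows "coboundary e \<phi> (contraction e i c) S x + contraction e i (coboundary e \<phi> c) S x = \<phi> i (c S) x"
proof (cases "i \<in> S")
  case True
  have z: "\<phi> j (contraction e i c (S - {j})) = (\<lambda>x. 0)" if "j \<in> S - {i}" for j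
  proof -
    have "contraction e i c (S - {j}) = (\<lambda>x. 0)" using that True by (auto simp: contraction_def)
    then show ?thesis by (simp add: linear_op_zero[OF assms(3)])
  qed
  have sgn: "sgn_in e i (S - {i}) = (sgn_in e i S :: 'k)"
    using True sgn_in_insert[of e i "S - {i}", where 'a = 'k] by (simp add: insert_absorb)
  have "contraction e i c (S - {i}) = (\<lambda>x. sgn_in e i S * c S x)"
    using sgn True by (auto simp: contraction_def insert_absorb)
  then have s: "\<phi> i (contraction e i c (S - {i})) x = sgn_in e i S * \<phi> i (c S) x"
    using linear_op_scale[OF assms(3), of i "sgn_in e i S" "c S"] by simp
  have "coboundary e \<phi> (contraction e i c) S x = sgn_in e i S * \<phi> i (contraction e i c (S - {i})) x +
      (\<Sum>j\<in>S - {i}. sgn_in e j S * \<phi> j (contraction e i c (S - {j})) x)"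
    unfolding coboundary_def using True assms by (simp add: sum.remove)
  moreover have "(\<Sum>j\<in>S - {i}. sgn_in e j S * \<phi> j (contraction e i c (S - {j})) x) = 0"
    by (rule sum.neutral) (simp add: z)
  ultimately have "coboundary e \<phi> (contraction e i c) S x = sgn_in e i S * sgn_in e i S * \<phi> i (c S) x"
    by (simp only: s mult.assoc add_0_right)
  then show ?thesis using True by (simp add: contraction_def sgn_in_square)
next
  case False
  have "contraction e i (coboundary e \<phi> c) S x = sgn_in e i S *
     (sgn_in e i S * \<phi> i (c S) x + (\<Sum>j\<in>S. sgn_in e j (insert i S) * \<phi> j (c (insert i S - {j})) x))"
    using False assms(1) by (simp add: contraction_def coboundary_def sgn_in_insert)
  also have "\<dots> = \<phi> i (c S) x +
      (\<Sum>j\<in>S. sgn_in e i S * sgn_in e j (insert i S) * \<phi> j (c (insert i S - {j})) x)"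
    by (simp only: distrib_left sum_distrib_left sgn_in_square mult_1_left mult.assoc[symmetric])
  finally have 1: "contraction e i (coboundary e \<phi> c) S x = \<phi> i (c S) x +
      (\<Sum>j\<in>S. sgn_in e i S * sgn_in e j (insert i S) * \<phi> j (c (insert i S - {j})) x)" .
  have "sgn_in e j S * \<phi> j (contraction e i c (S - {j})) x
      = - (sgn_in e i S * sgn_in e j (insert i S) * \<phi> j (c (insert i S - {j})) x)" if j: "j \<in> S" for j
  proof -
    have eq: "insert i (S - {j}) = insert i S - {j}" "insert i S - {i} = S" using False j by auto
    have "\<phi> j (contraction e i c (S - {j})) x = sgn_in e i (S - {j}) * \<phi> j (c (insert i S - {j})) x"
    proof -
      have "contraction e i c (S - {j}) = (\<lambda>x. sgn_in e i (S - {j}) * c (insert i S - {j}) x)"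
        using False by (simp add: contraction_def eq)
      then show ?thesis
        using linear_op_scale[OF assms(3), of j "sgn_in e i (S - {j})" "c (insert i S - {j})"] by simp
    qed
    then have "sgn_in e j S * \<phi> j (contraction e i c (S - {j})) x =
        (sgn_in e j S * sgn_in e i (S - {j})) * \<phi> j (c (insert i S - {j})) x"
      by (simp only: mult.assoc)
    moreover have "sgn_in e j S * sgn_in e i (S - {j}) = - (sgn_in e i S * sgn_in e j (insert i S) :: 'k)"
    proof -
      have "i \<noteq> j" using False j by auto
      then have "sgn_in e i (insert i S) * sgn_in e j (insert i S - {i})
          = - (sgn_in e j (insert i S) * sgn_in e i (insert i S - {j}) :: 'k)"
        using assms(1,2) j by (intro sgn_in_swap) auto
      then have "sgn_in e i S * sgn_in e j S = - (sgn_in e j (insert i S) * sgn_in e i (S - {j}) :: 'k)"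
        by (simp only: eq(2) eq(1)[symmetric] sgn_in_insert)
      then have "sgn_in e i S * (sgn_in e i S * sgn_in e j S) * sgn_in e i (S - {j})
          = - (sgn_in e i S * sgn_in e j (insert i S) * (sgn_in e i (S - {j}) * sgn_in e i (S - {j})) :: 'k)"
        by (simp only: mult_minus_left mult_minus_right mult.assoc mult.left_commute mult.commute)
      then show ?thesis by (simp only: sgn_in_square mult_1_left mult_1_right mult.assoc[symmetric])
    qed
    ultimately show ?thesis by (simp only: mult_minus_left)
  qed
  then have "coboundary e \<phi> (contraction e i c) S x =
     - (\<Sum>j\<in>S. sgn_in e i S * sgn_in e j (insert i S) * \<phi> j (c (insert i S - {j})) x)"
    unfolding coboundary_def sum_negf[symmetric] by (rule sum.cong[OF refl])
  then show ?thesis using 1 by simp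
qed

section \<open>Radicals\<close>

lemma is_ideal_radical:
  assumes A: "is_ideal A"
  shows "is_ideal (ideal_radical A)"
proof (rule ring_module.subspaceI)
  show "0 \<in> ideal_radical A"
    using ring_module.subspace_0[OF A] by (auto simp: ideal_radical_def intro: exI[of _ 1])
next
  fix x y assume "x \<in> ideal_radical A" "y \<in> ideal_radical A"
  then obtain m n where x: "x ^ m \<in> A" and y: "y ^ n \<in> A" by (auto simp: ideal_radical_def)
  have "of_nat (m + n choose k) * x ^ k * y ^ (m + n - k) \<in> A" for k
  proof (cases "m \<le> k")
    case True
    then have eq: "x ^ k = x ^ m * x ^ (k - m)" by (metis le_add_diff_inverse power_add)
    have "of_nat (m + n choose k) * x ^ k * y ^ (m + n - k)
        = (of_nat (m + n choose k) * x ^ (k - m) * y ^ (m + n - k)) * x ^ m"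
      unfolding eq by (simp only: mult.assoc mult.commute mult.left_commute)
    then show ?thesis using ring_module.subspace_scale[OF A x] by simp
  next
    case False
    then have "m + n - k = n + (m - k)" by simp
    then have eq: "y ^ (m + n - k) = y ^ n * y ^ (m - k)" by (metis power_add)
    have "of_nat (m + n choose k) * x ^ k * y ^ (m + n - k)
        = (of_nat (m + n choose k) * x ^ k * y ^ (m - k)) * y ^ n"
      unfolding eq by (simp only: mult.assoc mult.commute mult.left_commute)
    then show ?thesis using ring_module.subspace_scale[OF A y] by simp
  qed
  then have "(x + y) ^ (m + n) \<in> A"
    unfolding binomial_ring by (intro ring_module.subspace_sum[OF A])
  then show "x + y \<in> ideal_radical A" by (auto simp: ideal_radical_def)
next
  fix c x assume "x \<in> ideal_radical A"
  then obtain k where "x ^ k \<in> A" by (auto simp: ideal_radical_def)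
  then have "(c * x) ^ k \<in> A"
    unfolding power_mult_distrib by (intro ring_module.subspace_scale[OF A])
  then show "c * x \<in> ideal_radical A" by (auto simp: ideal_radical_def)
qed

lemma subset_ideal_radical: "A \<subseteq> ideal_radical A"
proof
  fix x assume "x \<in> A"
  then have "x ^ 1 \<in> A" by simp
  then show "x \<in> ideal_radical A" unfolding ideal_radical_def by blast
qed

lemma ideal_radical_powerD: "x ^ k \<in> ideal_radical A \<Longrightarrow> x \<in> ideal_radical A"
proof -
  assume "x ^ k \<in> ideal_radical A"
  then obtain l where "(x ^ k) ^ l \<in> A" by (auto simp: ideal_radical_def)
  then have "x ^ (k * l) \<in> A" by (simp only: power_mult)
  then show ?thesis unfolding ideal_radical_def by blast
qed

lemma ideal_radical_subset:
  assumes "A \<subseteq> ideal_radical B"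
  shows "ideal_radical A \<subseteq> ideal_radical B"
proof
  fix x assume "x \<in> ideal_radical A"
  then obtain k where "x ^ k \<in> A" by (auto simp: ideal_radical_def)
  then show "x \<in> ideal_radical B" using assms ideal_radical_powerD by blast
qed

lemma power_in_ideal_gen_powers:
  assumes "g \<in> ideal_gen (f ` J)"
  shows "\<exists>r. g ^ r \<in> ideal_gen ((\<lambda>j. f j ^ t) ` J)"
proof -
  let ?R = "ideal_radical (ideal_gen ((\<lambda>j. f j ^ t) ` J))"
  have "f j \<in> ?R" if "j \<in> J" for j
    unfolding ideal_radical_def using that by (auto intro!: exI[of _ t] ring_module.span_base)
  then have "ideal_gen (f ` J) \<subseteq> ?R"
    by (intro ring_module.span_minimal is_ideal_radical) auto
  then show ?thesis using assms by (auto simp: ideal_radical_def)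
qed

lemma ideal_gen_image_sum:
  assumes "x \<in> ideal_gen (f ` J)" "finite J"
  shows "\<exists>a. x = (\<Sum>j\<in>J. a j * f j)"
  using assms(1)
proof (induction rule: ring_module.span_induct_alt)
  case base
  show ?case by (rule exI[of _ "\<lambda>_. 0"]) simp
next
  case (step c x y)
  obtain j a where j: "j \<in> J" "x = f j" and a: "y = (\<Sum>j\<in>J. a j * f j)" using step by auto
  have "c * x + y = (\<Sum>i\<in>J. (if i = j then c * f i else 0)) + (\<Sum>i\<in>J. a i * f i)"
    using j a assms(2) by (simp add: sum.delta)
  also have "\<dots> = (\<Sum>i\<in>J. (a i + (if i = j then c else 0)) * f i)"
    unfolding sum.distrib[symmetric] by (intro sum.cong) (auto simp: distrib_right)
  finally show ?case by (rule exI[of _ "\<lambda>i. a i + (if i = j then c else 0)"])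
qed

section \<open>Polynomials acting on functions of Laurent exponents\<close>

lemma poly_mapping_single_sum:
  fixes f :: "'a \<Rightarrow>\<^sub>0 'b::comm_monoid_add"
  shows "(\<Sum>u\<in>Poly_Mapping.keys f. Poly_Mapping.single u (Poly_Mapping.lookup f u)) = f"
proof (rule poly_mapping_eqI)
  fix v
  have "Poly_Mapping.lookup (\<Sum>u\<in>Poly_Mapping.keys f. Poly_Mapping.single u (Poly_Mapping.lookup f u)) v
      = (\<Sum>u\<in>Poly_Mapping.keys f. if u = v then Poly_Mapping.lookup f u else 0)"
    unfolding lookup_sum by (intro sum.cong) (auto simp: lookup_single when_def)
  also have "\<dots> = Poly_Mapping.lookup f v"
    by (simp add: sum.delta in_keys_iff)
  finally show "Poly_Mapping.lookup (\<Sum>u\<in>Poly_Mapping.keys f.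
      Poly_Mapping.single u (Poly_Mapping.lookup f u)) v = Poly_Mapping.lookup f v" .
qed

lemma poly_mapping_add_induct [case_names zero single add]:
  fixes f :: "'a \<Rightarrow>\<^sub>0 'b::comm_monoid_add"
  assumes "P 0" "\<And>u c. P (Poly_Mapping.single u c)" "\<And>f g. P f \<Longrightarrow> P g \<Longrightarrow> P (f + g)"
  shows "P f"
proof -
  have "P (\<Sum>u\<in>A. Poly_Mapping.single u (Poly_Mapping.lookup f u))" if "finite A" for A
    using that by induction (simp_all add: assms)
  then show ?thesis using poly_mapping_single_sum[of f] by (metis finite_keys)
qed

text \<open>The monomial with exponent vector \<open>u\<close> acts by translation by \<open>u\<close>. Formally this is multiplication of
a Laurent series, possibly infinite in all directions and given by its coefficient function \<open>v\<close>,
by a polynomial.\<close>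

definition act :: "('n, 'k::field) mpol \<Rightarrow> (('n \<Rightarrow> int) \<Rightarrow> 'k) \<Rightarrow> ('n \<Rightarrow> int) \<Rightarrow> 'k"
  where "act f v = (\<lambda>a. \<Sum>u\<in>Poly_Mapping.keys f.
    Poly_Mapping.lookup f u * v (\<lambda>i. a i - int (Poly_Mapping.lookup u i)))"

lemma act_superset:
  assumes "finite A" "Poly_Mapping.keys f \<subseteq> A"
  shows "act f v a = (\<Sum>u\<in>A. Poly_Mapping.lookup f u * v (\<lambda>i. a i - int (Poly_Mapping.lookup u i)))"
  unfolding act_def
proof (rule sum.mono_neutral_left[OF assms])
  show "\<forall>u\<in>A - Poly_Mapping.keys f. Poly_Mapping.lookup f u * v (\<lambda>i. a i - int (Poly_Mapping.lookup u i)) = 0"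
    by (simp add: not_in_keys_iff_lookup_eq_zero)
qed

lemma act_add_left: "act (f + g) v a = act f v a + act g v a"
proof -
  let ?A = "Poly_Mapping.keys f \<union> Poly_Mapping.keys g"
  have "act (f + g) v a = (\<Sum>u\<in>?A. Poly_Mapping.lookup (f + g) u * v (\<lambda>i. a i - int (Poly_Mapping.lookup u i)))"
    using Poly_Mapping.keys_add[of f g] by (intro act_superset) auto
  also have "\<dots> = act f v a + act g v a"
    by (simp add: act_superset[of ?A f] act_superset[of ?A g] lookup_add distrib_right sum.distrib)
  finally show ?thesis .
qed

lemma act_zero_left [simp]: "act 0 v a = 0"
  by (simp add: act_def)

lemma act_sum_left: "act (\<Sum>j\<in>J. f j) v a = (\<Sum>j\<in>J. act (f j) v a)"
  by (induction J rule: infinite_finite_induct) (simp_all add: act_add_left)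

lemma act_single: "act (Poly_Mapping.single u c) v a = c * v (\<lambda>i. a i - int (Poly_Mapping.lookup u i))"
  by (cases "c = 0") (simp_all add: act_def)

lemma act_one [simp]: "act 1 v = v"
proof
  show "act 1 v a = v a" for a using act_single[of 0 1 v a] by simp
qed

lemma linear_op_act: "linear_op (act f)"
proof -
  have "act f (\<lambda>x. v x + w x) = (\<lambda>y. act f v y + act f w y)" for v w
    unfolding act_def by (simp only: distrib_left sum.distrib)
  moreover have "act f (\<lambda>x. r * v x) = (\<lambda>y. r * act f v y)" for r v
    unfolding act_def by (simp only: sum_distrib_left mult.left_commute)
  ultimately show ?thesis unfolding linear_op_def by blast
qed

lemma act_mult: "act (f * g) v = act f (act g v)"
proof
  fix a
  show "act (f * g) v a = act f (act g v) a"
  proof (induction f rule: poly_mapping_add_induct)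
    case (single u c)
    show ?case
    proof (induction g rule: poly_mapping_add_induct)
      case (single w d)
      have "(\<lambda>i. a i - int (Poly_Mapping.lookup (u + w) i))
          = (\<lambda>i. a i - int (Poly_Mapping.lookup u i) - int (Poly_Mapping.lookup w i))"
        by (simp add: lookup_add fun_eq_iff)
      then show ?case by (simp only: mult_single act_single mult.assoc)
    next
      case (add g h)
      have "act (g + h) v = (\<lambda>a. act g v a + act h v a)" by (simp add: act_add_left fun_eq_iff)
      then have "act (Poly_Mapping.single u c) (act (g + h) v) a =
          act (Poly_Mapping.single u c) (act g v) a + act (Poly_Mapping.single u c) (act h v) a"
        by (simp only: linear_op_add[OF linear_op_act])
      moreover have "act (Poly_Mapping.single u c * (g + h)) v a =
          act (Poly_Mapping.single u c * g) v a + act (Poly_Mapping.single u c * h) v a"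
        by (simp only: distrib_left act_add_left)
      ultimately show ?case using add by argo
    qed (simp add: act_single)
  qed (simp_all add: distrib_right act_add_left)
qed

lemma act_commute: "act f (act g v) = act g (act f v)"
  by (metis act_mult mult.commute)

text \<open>Since exponents of polynomials are nonnegative, the action only looks downwards. Hence it respects
equality of functions on the region where \<open>a i < 0\<close> for all \<open>i\<close> in a set \<open>T\<close>, and the module
\<open>M\<^sub>T\<close> of functions on that region never has to be formed as a quotient.\<close>

lemma act_cong_below:
  assumes "\<And>b. (\<And>i. b i \<le> a i) \<Longrightarrow> v b = w b"
  shows "act f v a = act f w a"
  unfolding act_def by (intro sum.cong refl arg_cong2[where f = "(*)"] assms) simp

text \<open>Replaces finiteness of the support: it makes elements torsion
(\<open>act_power_eventually_zero\<close>), and unlike membership in \<open>R\<close> it survives translations in both directions.\<close>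

definition bounded_below :: "(('n \<Rightarrow> int) \<Rightarrow> 'k::field) \<Rightarrow> bool"
  where "bounded_below v \<longleftrightarrow> (\<exists>k. \<forall>a. v a \<noteq> 0 \<longrightarrow> (\<forall>i. k \<le> a i))"

lemma bounded_below_zero: "bounded_below (\<lambda>a. 0)"
  by (simp add: bounded_below_def)

lemma bounded_below_scale: "bounded_below v \<Longrightarrow> bounded_below (\<lambda>a. r a * v a)"
  by (auto simp: bounded_below_def)

lemma bounded_below_add:
  assumes "bounded_below v" "bounded_below w"
  shows "bounded_below (\<lambda>a. v a + w a)"
proof -
  obtain k where k: "\<forall>a. v a \<noteq> 0 \<longrightarrow> (\<forall>i. k \<le> a i)" using assms(1) unfolding bounded_below_def by blast
  obtain l where l: "\<forall>a. w a \<noteq> 0 \<longrightarrow> (\<forall>i. l \<le> a i)" using assms(2) unfolding bounded_below_def by blast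
  show ?thesis unfolding bounded_below_def
  proof (intro exI[of _ "min k l"] allI impI)
    fix a i assume "v a + w a \<noteq> 0"
    then have "v a \<noteq> 0 \<or> w a \<noteq> 0" by auto
    then have "k \<le> a i \<or> l \<le> a i" using k l by blast
    then show "min k l \<le> a i" by auto
  qed
qed

lemma bounded_below_sum: "(\<And>i. i \<in> A \<Longrightarrow> bounded_below (v i)) \<Longrightarrow> bounded_below (\<lambda>a. \<Sum>i\<in>A. v i a)"
  by (induction A rule: infinite_finite_induct) (simp_all add: bounded_below_zero bounded_below_add)

lemma bounded_below_shift:
  fixes s :: "'n::finite \<Rightarrow> int"
  assumes "bounded_below v"
  shows "bounded_below (\<lambda>a. v (\<lambda>i. a i + s i))"
proof -
  obtain k where k: "\<forall>a. v a \<noteq> 0 \<longrightarrow> (\<forall>i. k \<le> a i)" using assms unfolding bounded_below_def by blast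
  show ?thesis unfolding bounded_below_def
  proof (intro exI[of _ "k - Max (range s)"] allI impI)
    fix a i assume "v (\<lambda>i. a i + s i) \<noteq> 0"
    then have "k \<le> a i + s i" using k by blast
    moreover have "s i \<le> Max (range s)" by simp
    ultimately show "k - Max (range s) \<le> a i" by linarith
  qed
qed

lemma bounded_below_act:
  fixes v :: "('n::finite \<Rightarrow> int) \<Rightarrow> 'k::field"
  shows "bounded_below v \<Longrightarrow> bounded_below (act f v)"
  unfolding act_def diff_conv_add_uminus
  by (intro bounded_below_sum bounded_below_scale bounded_below_shift)

section \<open>The double complex\<close>

lemma linear_op_sum_plain:
  assumes "linear_op \<phi>"
  shows "\<phi> (\<lambda>x. \<Sum>i\<in>A. v i x) = (\<lambda>y. \<Sum>i\<in>A. \<phi> (v i) y)"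
  using linear_op_sum[OF assms, where A = A and r = "\<lambda>_. 1" and v = v] by simp

lemma keys_power_weight:
  fixes g :: "('n, 'k::field) mpol"
  assumes "finite T" "\<And>u. u \<in> Poly_Mapping.keys g \<Longrightarrow> \<exists>i\<in>T. Poly_Mapping.lookup u i \<noteq> 0"
    and "u \<in> Poly_Mapping.keys (g ^ r)"
  shows "r \<le> (\<Sum>i\<in>T. Poly_Mapping.lookup u i)"
  using assms(3)
proof (induction r arbitrary: u)
  case (Suc r)
  then obtain v w where vw: "v \<in> Poly_Mapping.keys g" "w \<in> Poly_Mapping.keys (g ^ r)" "u = v + w"
    using keys_mult[of g "g ^ r"] by auto
  obtain i where i: "i \<in> T" "Poly_Mapping.lookup v i \<noteq> 0" using assms(2)[OF vw(1)] by blast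
  have "Poly_Mapping.lookup v i \<le> (\<Sum>i\<in>T. Poly_Mapping.lookup v i)"
    using assms(1) i by (intro member_le_sum) auto
  then show ?case using Suc.IH[OF vw(2)] i by (simp add: vw(3) lookup_add sum.distrib)
qed simp

text \<open>Every monomial of \<open>g ^ s\<close> has large total degree in the variables of \<open>T\<close> when \<open>s\<close> is large, so
it translates every exponent at which \<open>v\<close> is nonzero, these being bounded below, out of the
region where all exponents in \<open>T\<close> are negative.\<close>

lemma act_power_eventually_zero:
  fixes g :: "('n::finite, 'k::field) mpol"
  assumes "\<And>u. u \<in> Poly_Mapping.keys (g ^ k) \<Longrightarrow> \<exists>i\<in>T. Poly_Mapping.lookup u i \<noteq> 0"
    and "bounded_below v"
  shows "\<exists>s. \<forall>s'\<ge>s. \<forall>a. (\<forall>i\<in>T. a i < 0) \<longrightarrow> act (g ^ s') v a = 0"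
proof -
  obtain l where l: "\<forall>a. v a \<noteq> 0 \<longrightarrow> (\<forall>i. l \<le> a i)"
    using assms(2) unfolding bounded_below_def by blast
  define r where "r = Suc (card T * nat \<bar>l\<bar>)"
  have zero: "act ((g ^ k) ^ r) v b = 0" if b: "\<forall>i\<in>T. b i < 0" for b
    unfolding act_def
  proof (rule sum.neutral, rule ballI)
    fix u assume u: "u \<in> Poly_Mapping.keys ((g ^ k) ^ r)"
    have "v (\<lambda>i. b i - int (Poly_Mapping.lookup u i)) = 0"
    proof (rule ccontr)
      assume "v (\<lambda>i. b i - int (Poly_Mapping.lookup u i)) \<noteq> 0"
      then have "l \<le> b i - int (Poly_Mapping.lookup u i)" for i using l by blast
      then have "Poly_Mapping.lookup u i \<le> nat \<bar>l\<bar>" if "i \<in> T" for i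
        using b that by (smt (verit) nat_le_iff zle_int of_nat_nat)
      then have "(\<Sum>i\<in>T. Poly_Mapping.lookup u i) \<le> card T * nat \<bar>l\<bar>"
        using sum_bounded_above[of T "Poly_Mapping.lookup u" "nat \<bar>l\<bar>"] by simp
      then show False using keys_power_weight[OF _ assms(1) u] by (simp add: r_def)
    qed
    then show "Poly_Mapping.lookup ((g ^ k) ^ r) u * v (\<lambda>i. b i - int (Poly_Mapping.lookup u i)) = 0"
      by simp
  qed
  have "act (g ^ s') v a = 0" if s: "k * r \<le> s'" and a: "\<forall>i\<in>T. a i < 0" for s' a
  proof -
    have "g ^ s' = g ^ (s' - k * r) * (g ^ k) ^ r"
      using s by (simp flip: power_mult power_add)
    then have "act (g ^ s') v a = act (g ^ (s' - k * r)) (act ((g ^ k) ^ r) v) a"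
      by (simp only: act_mult)
    also have "\<dots> = act (g ^ (s' - k * r)) (\<lambda>b. 0) a"
    proof (rule act_cong_below)
      fix b assume b: "\<And>i. b i \<le> a i"
      show "act ((g ^ k) ^ r) v b = 0"
        by (rule zero) (use a b le_less_trans in blast)
    qed
    also have "\<dots> = 0" by (simp add: act_def)
    finally show ?thesis .
  qed
  then show ?thesis by blast
qed

text \<open>A cochain has values at finite sets \<open>S \<subseteq> J\<close> (the Koszul direction) and \<open>T \<in> \<Delta>\<close> (the
simplicial direction), in the module \<open>M\<^sub>T\<close>. The hypothesis \<open>invertible\<close> provides a monomial
that acts invertibly on \<open>M\<^sub>T\<close> and lies in the ideal of the powers \<open>f j ^ t\<close>; it holds for bases
disjoint from \<open>T\<close>. The hypothesis \<open>nilpotent\<close> makes the \<open>M\<^sub>T\<close> with \<open>T \<notin> \<Delta>\<close> torsion.\<close>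

locale double_complex =
  fixes e :: "'n::finite \<Rightarrow> nat" and f :: "nat \<Rightarrow> ('n, 'k::field) mpol" and J :: "nat set"
    and \<Delta> :: "'n set set"
  assumes inj_e: "inj e" and finite_J: "finite J"
    and down_closed: "T \<in> \<Delta> \<Longrightarrow> T' \<subseteq> T \<Longrightarrow> T' \<in> \<Delta>"
    and invertible: "T \<in> \<Delta> \<Longrightarrow> \<exists>w a. (\<forall>i\<in>T. Poly_Mapping.lookup w i = 0) \<and>
      mono_poly w = (\<Sum>j\<in>J. a j * f j ^ t)"
    and nilpotent: "T \<notin> \<Delta> \<Longrightarrow> j \<in> J \<Longrightarrow>
      \<exists>k. \<forall>u\<in>Poly_Mapping.keys (f j ^ k). \<exists>i\<in>T. Poly_Mapping.lookup u i \<noteq> 0"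
begin

type_synonym ('m, 'l) cochain = "nat set \<Rightarrow> 'm set \<Rightarrow> ('m \<Rightarrow> int) \<Rightarrow> 'l"

definition koszul :: "nat \<Rightarrow> ('n, 'k) cochain \<Rightarrow> ('n, 'k) cochain"
  where "koszul t c = (\<lambda>S T. coboundary (\<lambda>j. j) (\<lambda>j. act (f j ^ t)) (\<lambda>S'. c S' T) S)"

definition simplicial :: "('n, 'k) cochain \<Rightarrow> ('n, 'k) cochain"
  where "simplicial c = (\<lambda>S. coboundary e (\<lambda>i v. v) (c S))"

text \<open>The transition from the Koszul complex on the \<open>f j ^ t\<close> to the one on the \<open>f j ^ (t + s)\<close>. The
direct limit along these maps is the Cech complex; working at finite \<open>t\<close> avoids localizations.\<close>

definition transit :: "nat \<Rightarrow> ('n, 'k) cochain \<Rightarrow> ('n, 'k) cochain"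
  where "transit s c = (\<lambda>S T. act (\<Prod>j\<in>S. f j ^ s) (c S T))"

definition plus_c :: "('n, 'k) cochain \<Rightarrow> ('n, 'k) cochain \<Rightarrow> ('n, 'k) cochain"
  where "plus_c c c' = (\<lambda>S T a. c S T a + c' S T a)"

definition minus_c :: "('n, 'k) cochain \<Rightarrow> ('n, 'k) cochain \<Rightarrow> ('n, 'k) cochain"
  where "minus_c c c' = (\<lambda>S T a. c S T a - c' S T a)"

text \<open>Equality of the components of bidegree \<open>(p, q)\<close>, tested only where they carry meaning: at
\<open>T \<in> \<Delta>\<close> and exponents negative on \<open>T\<close>. Cochains are not required to vanish elsewhere.\<close>

definition eq_at :: "nat \<Rightarrow> nat \<Rightarrow> ('n, 'k) cochain \<Rightarrow> ('n, 'k) cochain \<Rightarrow> bool"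
  where "eq_at p q c c' \<longleftrightarrow> (\<forall>S T a. S \<subseteq> J \<longrightarrow> card S = p \<longrightarrow> T \<in> \<Delta> \<longrightarrow> card T = q \<longrightarrow>
    (\<forall>i\<in>T. a i < 0) \<longrightarrow> c S T a = c' S T a)"

abbreviation zero_c :: "('n, 'k) cochain" where "zero_c \<equiv> \<lambda>S T a. 0"

definition bounded_c :: "('n, 'k) cochain \<Rightarrow> bool"
  where "bounded_c c \<longleftrightarrow> (\<forall>S T. bounded_below (c S T))"

lemma linear_id: "linear_op (\<lambda>v. v)"
  by (simp add: linear_op_def)

lemma koszul_koszul: "finite S \<Longrightarrow> koszul t (koszul t c) S T = (\<lambda>a. 0)"
  unfolding koszul_def by (rule coboundary_coboundary) (auto intro: linear_op_act act_commute)

lemma simplicial_simplicial: "simplicial (simplicial c) S T = (\<lambda>a. 0)"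
  unfolding simplicial_def by (rule coboundary_coboundary) (auto intro: linear_id inj_e)

lemma koszul_simplicial: "koszul t (simplicial c) = simplicial (koszul t c)"
proof (intro ext)
  fix S T a
  have "koszul t (simplicial c) S T a = (\<Sum>j\<in>S. \<Sum>i\<in>T. sgn_in (\<lambda>j. j) j S * (sgn_in e i T *
      act (f j ^ t) (c (S - {j}) (T - {i})) a))"
    unfolding koszul_def simplicial_def coboundary_def linear_op_sum[OF linear_op_act] sum_distrib_left ..
  also have "\<dots> = (\<Sum>i\<in>T. \<Sum>j\<in>S. sgn_in (\<lambda>j. j) j S * (sgn_in e i T *
      act (f j ^ t) (c (S - {j}) (T - {i})) a))"
    by (rule sum.swap)
  also have "\<dots> = (\<Sum>i\<in>T. \<Sum>j\<in>S. sgn_in e i T * (sgn_in (\<lambda>j. j) j S *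
      act (f j ^ t) (c (S - {j}) (T - {i})) a))"
    by (simp only: mult.left_commute)
  also have "\<dots> = simplicial (koszul t c) S T a"
    unfolding koszul_def simplicial_def coboundary_def sum_distrib_left ..
  finally show "koszul t (simplicial c) S T a = simplicial (koszul t c) S T a" .
qed

lemma transit_simplicial: "transit s (simplicial c) = simplicial (transit s c)"
  unfolding transit_def simplicial_def coboundary_def linear_op_sum[OF linear_op_act] ..

lemma transit_koszul:
  assumes "finite S"
  shows "koszul (t + s) (transit s c) S T = transit s (koszul t c) S T"
proof
  fix a
  have "act (f j ^ (t + s)) (act (\<Prod>j\<in>S - {j}. f j ^ s) v) = act (\<Prod>j\<in>S. f j ^ s) (act (f j ^ t) v)"
    if j: "j \<in> S" for j v
  proof -
    have "f j ^ (t + s) * (\<Prod>j\<in>S - {j}. f j ^ s) = (f j ^ s * (\<Prod>j\<in>S - {j}. f j ^ s)) * f j ^ t"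
      by (simp only: power_add mult.assoc mult.commute mult.left_commute)
    also have "f j ^ s * (\<Prod>j\<in>S - {j}. f j ^ s) = (\<Prod>j\<in>S. f j ^ s)"
      by (rule prod.remove[OF assms j, symmetric])
    finally show ?thesis by (simp only: act_mult[symmetric])
  qed
  then show "koszul (t + s) (transit s c) S T a = transit s (koszul t c) S T a"
    unfolding koszul_def transit_def coboundary_def linear_op_sum[OF linear_op_act]
    by (intro sum.cong refl arg_cong2[where f = "(*)"]) (simp only:)
qed

lemma koszul_plus: "koszul t (plus_c c c') = plus_c (koszul t c) (koszul t c')"
  unfolding koszul_def plus_c_def coboundary_def linear_op_add[OF linear_op_act]
  by (simp only: distrib_left sum.distrib)

lemma simplicial_plus: "simplicial (plus_c c c') = plus_c (simplicial c) (simplicial c')"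
  unfolding simplicial_def plus_c_def coboundary_def by (simp only: distrib_left sum.distrib)

lemma koszul_minus: "koszul t (minus_c c c') = minus_c (koszul t c) (koszul t c')"
proof -
  have "koszul t c = plus_c (koszul t (minus_c c c')) (koszul t c')"
    unfolding koszul_plus[symmetric] by (simp add: plus_c_def minus_c_def)
  then show ?thesis by (simp add: plus_c_def minus_c_def fun_eq_iff)
qed

lemma eq_at_sym: "eq_at p q c c' \<Longrightarrow> eq_at p q c' c"
  and eq_at_trans [trans]: "eq_at p q c c' \<Longrightarrow> eq_at p q c' c'' \<Longrightarrow> eq_at p q c c''"
  by (auto simp: eq_at_def)

lemma eq_at_minus: "eq_at p q (minus_c c c') zero_c \<longleftrightarrow> eq_at p q c c'"
  by (simp add: eq_at_def minus_c_def)

lemma eq_at_minus_plus: "eq_at p q (minus_c c c') c'' \<Longrightarrow> eq_at p q c (plus_c c' c'')"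
  by (auto simp: eq_at_def minus_c_def plus_c_def algebra_simps)

lemma eq_at_transit:
  assumes "eq_at p q c c'"
  shows "eq_at p q (transit s c) (transit s c')"
  unfolding eq_at_def transit_def
proof (intro allI impI)
  fix S T and a :: "'n \<Rightarrow> int"
  assume *: "S \<subseteq> J" "card S = p" "T \<in> \<Delta>" "card T = q" "\<forall>i\<in>T. a i < 0"
  show "act (\<Prod>j\<in>S. f j ^ s) (c S T) a = act (\<Prod>j\<in>S. f j ^ s) (c' S T) a"
  proof (rule act_cong_below)
    fix b assume "\<And>i. b i \<le> a i"
    then have "\<forall>i\<in>T. b i < 0" using *(5) le_less_trans by blast
    then show "c S T b = c' S T b" using assms * by (auto simp: eq_at_def)
  qed
qed

lemma eq_at_simplicial:
  assumes "eq_at p q c c'"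
  shows "eq_at p (Suc q) (simplicial c) (simplicial c')"
  unfolding eq_at_def simplicial_def coboundary_def
proof (intro allI impI sum.cong refl arg_cong2[where f = "(*)"])
  fix S T i and a :: "'n \<Rightarrow> int"
  assume *: "S \<subseteq> J" "card S = p" "T \<in> \<Delta>" "card T = Suc q" "\<forall>i\<in>T. a i < 0" "i \<in> T"
  have "T - {i} \<in> \<Delta>" using down_closed[OF *(3)] by blast
  then show "c S (T - {i}) a = c' S (T - {i}) a" using assms * by (auto simp: eq_at_def)
qed

lemma eq_at_koszul:
  assumes "eq_at p q c c'"
  shows "eq_at (Suc p) q (koszul t c) (koszul t c')"
  unfolding eq_at_def koszul_def coboundary_def
proof (intro allI impI sum.cong refl arg_cong2[where f = "(*)"])
  fix S T j and a :: "'n \<Rightarrow> int"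
  assume *: "S \<subseteq> J" "card S = Suc p" "T \<in> \<Delta>" "card T = q" "\<forall>i\<in>T. a i < 0" "j \<in> S"
  have S: "S - {j} \<subseteq> J" "card (S - {j}) = p" using * finite_J by (auto simp: finite_subset)
  show "act (f j ^ t) (c (S - {j}) T) a = act (f j ^ t) (c' (S - {j}) T) a"
  proof (rule act_cong_below)
    fix b assume "\<And>i. b i \<le> a i"
    then have "\<forall>i\<in>T. b i < 0" using *(5) le_less_trans by blast
    then show "c (S - {j}) T b = c' (S - {j}) T b" using assms * S by (auto simp: eq_at_def)
  qed
qed

lemma bounded_c_koszul: "bounded_c c \<Longrightarrow> bounded_c (koszul t c)"
  unfolding bounded_c_def koszul_def coboundary_def
  by (intro allI bounded_below_sum bounded_below_scale bounded_below_act) simp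

lemma bounded_c_simplicial: "bounded_c c \<Longrightarrow> bounded_c (simplicial c)"
  unfolding bounded_c_def simplicial_def coboundary_def
  by (intro allI bounded_below_sum bounded_below_scale) simp

lemma bounded_c_transit: "bounded_c c \<Longrightarrow> bounded_c (transit s c)"
  unfolding bounded_c_def transit_def by (blast intro: bounded_below_act)

lemma bounded_c_minus:
  assumes "bounded_c c" "bounded_c c'"
  shows "bounded_c (minus_c c c')"
proof -
  have "bounded_below (\<lambda>a. c S T a + - 1 * c' S T a)" for S T
    using assms unfolding bounded_c_def by (intro bounded_below_add bounded_below_scale) auto
  then show ?thesis by (simp add: bounded_c_def minus_c_def)
qed

text \<open>For fixed \<open>T\<close>, write the monomial \<open>w\<close> of the hypothesis \<open>invertible\<close> as \<open>\<Sum>j\<in>J. a j * f j ^ t\<close>. The combination of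
the contractions by \<open>j\<close> with coefficients \<open>a j\<close> is a homotopy between multiplication by \<open>w\<close> and
zero, and the translation \<open>sh\<close> undoes multiplication by \<open>w\<close>. For \<open>p = 0\<close> the conclusion says that
\<open>c\<close> vanishes in degree \<open>(0, q)\<close>, as the Koszul coboundary is then an empty sum.\<close>

lemma koszul_exact:
  assumes "bounded_c c" "eq_at (Suc p) q (koszul t c) zero_c"
  shows "\<exists>\<theta>. bounded_c \<theta> \<and> eq_at p q c (koszul t \<theta>)"
proof -
  have "\<exists>wa. T \<in> \<Delta> \<longrightarrow> (\<forall>i\<in>T. Poly_Mapping.lookup (fst wa) i = 0) \<and>
      mono_poly (fst wa) = (\<Sum>j\<in>J. snd wa j * f j ^ t)" for T
    using invertible[of T t] by simp
  then have "\<forall>T. \<exists>wa. T \<in> \<Delta> \<longrightarrow> (\<forall>i\<in>T. Poly_Mapping.lookup (fst wa) i = 0) \<and>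
      mono_poly (fst wa) = (\<Sum>j\<in>J. snd wa j * f j ^ t)" by (rule allI)
  from choice[OF this] obtain wa where wa: "\<forall>T. T \<in> \<Delta> \<longrightarrow>
      (\<forall>i\<in>T. Poly_Mapping.lookup (fst (wa T)) i = 0) \<and>
      mono_poly (fst (wa T)) = (\<Sum>j\<in>J. snd (wa T) j * f j ^ t)" ..
  define w \<alpha> where "w T = fst (wa T)" and "\<alpha> T = snd (wa T)" for T
  have w: "Poly_Mapping.lookup (w T) i = 0" if "T \<in> \<Delta>" "i \<in> T" for T i
    using wa that by (simp add: w_def)
  have \<alpha>: "mono_poly (w T) = (\<Sum>j\<in>J. \<alpha> T j * f j ^ t)" if "T \<in> \<Delta>" for T
    using wa that by (simp add: w_def \<alpha>_def)
  define sh where "sh T v = (\<lambda>a. v (\<lambda>i. a i + int (Poly_Mapping.lookup (w T) i)))"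
    for T and v :: "('n \<Rightarrow> int) \<Rightarrow> 'k"
  have sh_act: "sh T (act g v) = act g (sh T v)" for T g v
    by (simp add: sh_def act_def algebra_simps)
  have sh_w: "sh T (act (mono_poly (w T)) v) = v" for T v
    by (simp add: sh_def act_single)
  define h where "h S T = (\<lambda>a. \<Sum>j\<in>J. act (\<alpha> T j) (contraction (\<lambda>j. j) j (\<lambda>S'. c S' T) S) a)" for S T
  define \<theta> where "\<theta> S T = sh T (h S T)" for S T
  have "bounded_below (contraction (\<lambda>j. j) j (\<lambda>S'. c S' T) S)" for j S T
    using assms(1) unfolding contraction_def bounded_c_def
    by (cases "j \<in> S") (simp_all add: bounded_below_zero bounded_below_scale)
  then have "bounded_c \<theta>"
    unfolding bounded_c_def \<theta>_def sh_def h_def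
    by (intro allI bounded_below_shift bounded_below_sum bounded_below_act)
  moreover have "eq_at p q c (koszul t \<theta>)"
    unfolding eq_at_def
  proof (intro allI impI)
    fix S T and a :: "'n \<Rightarrow> int"
    assume *: "S \<subseteq> J" "card S = p" "T \<in> \<Delta>" "card T = q" "\<forall>i\<in>T. a i < 0"
    have fin: "finite S" using * finite_J by (auto simp: finite_subset)
    define b where "b = (\<lambda>i. a i + int (Poly_Mapping.lookup (w T) i))"
    have b: "\<forall>i\<in>T. b i < 0" using * w by (simp add: b_def)
    have vanish: "act (\<alpha> T j) (contraction (\<lambda>j. j) j (\<lambda>S'. koszul t c S' T) S) b = 0" if "j \<in> J" for j
    proof -
      have "act (\<alpha> T j) (contraction (\<lambda>j. j) j (\<lambda>S'. koszul t c S' T) S) b = act (\<alpha> T j) (\<lambda>b. 0) b"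
      proof (rule act_cong_below)
        fix b' assume "\<And>i. b' i \<le> b i"
        then have b': "\<forall>i\<in>T. b' i < 0" using b le_less_trans by blast
        have "koszul t c (insert j S) T b' = 0" if "j \<notin> S"
          using assms(2) * b' fin that \<open>j \<in> J\<close> by (simp add: eq_at_def)
        then show "contraction (\<lambda>j. j) j (\<lambda>S'. koszul t c S' T) S b' = 0" by (simp add: contraction_def)
      qed
      then show ?thesis by (simp add: act_def)
    qed
    have homotopy: "act (\<alpha> T j) (coboundary (\<lambda>j. j) (\<lambda>j. act (f j ^ t)) (contraction (\<lambda>j. j) j (\<lambda>S'. c S' T)) S) b
        = act (\<alpha> T j * f j ^ t) (c S T) b" if "j \<in> J" for j
    proof -
      let ?X = "coboundary (\<lambda>j. j) (\<lambda>j. act (f j ^ t)) (contraction (\<lambda>j. j) j (\<lambda>S'. c S' T)) S"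
      let ?Y = "contraction (\<lambda>j. j) j (\<lambda>S'. koszul t c S' T) S"
      have "?X x + ?Y x = act (f j ^ t) (c S T) x" for x
        unfolding koszul_def by (rule coboundary_contraction) (auto simp: fin linear_op_act)
      then have "act (\<alpha> T j) (act (f j ^ t) (c S T)) b = act (\<alpha> T j) (\<lambda>x. ?X x + ?Y x) b"
        by (simp only:)
      also have "\<dots> = act (\<alpha> T j) ?X b + act (\<alpha> T j) ?Y b"
        by (simp only: linear_op_add[OF linear_op_act])
      finally show ?thesis using vanish[OF that] by (simp only: act_mult add_0_right)
    qed
    have "koszul t \<theta> S T a = coboundary (\<lambda>j. j) (\<lambda>j. act (f j ^ t)) (\<lambda>S'. h S' T) S b"
      by (simp add: koszul_def coboundary_def \<theta>_def b_def flip: sh_act) (simp add: sh_def)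
    also have "\<dots> = (\<Sum>i\<in>S. \<Sum>j\<in>J. sgn_in (\<lambda>j. j) i S *
        act (\<alpha> T j) (act (f i ^ t) (contraction (\<lambda>j. j) j (\<lambda>S'. c S' T) (S - {i}))) b)"
      unfolding coboundary_def h_def linear_op_sum_plain[OF linear_op_act] sum_distrib_left
      by (intro sum.cong refl arg_cong2[where f = "(*)"] fun_cong[OF act_commute])
    also have "\<dots> = (\<Sum>j\<in>J. \<Sum>i\<in>S. sgn_in (\<lambda>j. j) i S *
        act (\<alpha> T j) (act (f i ^ t) (contraction (\<lambda>j. j) j (\<lambda>S'. c S' T) (S - {i}))) b)"
      by (rule sum.swap)
    also have "\<dots> = (\<Sum>j\<in>J. act (\<alpha> T j) (coboundary (\<lambda>j. j) (\<lambda>j. act (f j ^ t)) (contraction (\<lambda>j. j) j (\<lambda>S'. c S' T)) S) b)"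
      unfolding coboundary_def linear_op_sum[OF linear_op_act] ..
    also have "\<dots> = (\<Sum>j\<in>J. act (\<alpha> T j * f j ^ t) (c S T) b)"
      by (rule sum.cong[OF refl]) (rule homotopy)
    also have "\<dots> = act (mono_poly (w T)) (c S T) b"
      unfolding \<alpha>[OF *(3)] act_sum_left ..
    also have "\<dots> = c S T a"
      using fun_cong[OF sh_w[of T "c S T"], of a] by (simp add: sh_def b_def)
    finally show "c S T a = koszul t \<theta> S T a" by simp
  qed
  ultimately show ?thesis by blast
qed

text \<open>A cocycle over \<open>\<Delta>\<close> need not be one over all sets \<open>T\<close>, but the offending components lie at \<open>T \<notin> \<Delta>\<close>
and are killed by a high power of any \<open>f j\<close> with \<open>j \<in> S\<close>; such a \<open>j\<close> exists as \<open>p\<close> is positive.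
After that the complex splits: at a fixed exponent \<open>a\<close> only the
subsets of \<open>{i. a i < 0}\<close> matter, and contraction by any element of this set is a homotopy. It
is nonempty because \<open>T\<close> is, which is why the degree must be positive.\<close>

lemma simplicial_exact:
  assumes "bounded_c c" "eq_at p (Suc (Suc q)) (simplicial c) zero_c" "1 \<le> p"
  shows "\<exists>s \<eta>. bounded_c \<eta> \<and> eq_at p (Suc q) (transit s c) (simplicial \<eta>)"
proof -
  have "\<exists>s. \<forall>s'\<ge>s. \<forall>a. S \<subseteq> J \<longrightarrow> card S = p \<longrightarrow> T \<notin> \<Delta> \<longrightarrow> (\<forall>i\<in>T. a i < 0) \<longrightarrow>
      transit s' (simplicial c) S T a = 0" for S T
  proof (cases "S \<subseteq> J \<and> card S = p \<and> T \<notin> \<Delta>")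
    case True
    then have "S \<noteq> {}" using assms(3) by auto
    then obtain j where j: "j \<in> S" by blast
    have fin: "finite S" using True finite_J by (auto simp: finite_subset)
    obtain k where "\<forall>u\<in>Poly_Mapping.keys (f j ^ k). \<exists>i\<in>T. Poly_Mapping.lookup u i \<noteq> 0"
      using nilpotent[of T j] True j by blast
    moreover have "bounded_below (simplicial c S T)"
      using bounded_c_simplicial[OF assms(1)] by (simp add: bounded_c_def)
    ultimately obtain s where s: "\<And>s' a. s \<le> s' \<Longrightarrow> \<forall>i\<in>T. a i < 0 \<Longrightarrow> act (f j ^ s') (simplicial c S T) a = 0"
      using act_power_eventually_zero[of "f j" k T "simplicial c S T"] by blast
    have "transit s' (simplicial c) S T a = 0" if "s \<le> s'" "\<forall>i\<in>T. a i < 0" for s' a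
    proof -
      have "(\<Prod>j\<in>S. f j ^ s') = (\<Prod>j\<in>S - {j}. f j ^ s') * f j ^ s'"
        using prod.remove[OF fin j] by (simp add: mult.commute)
      then have "transit s' (simplicial c) S T a = act (\<Prod>j\<in>S - {j}. f j ^ s') (act (f j ^ s') (simplicial c S T)) a"
        by (simp only: transit_def act_mult)
      also have "\<dots> = act (\<Prod>j\<in>S - {j}. f j ^ s') (\<lambda>b. 0) a"
      proof (rule act_cong_below)
        fix b assume "\<And>i. b i \<le> a i"
        then have "\<forall>i\<in>T. b i < 0" using that(2) le_less_trans by blast
        then show "act (f j ^ s') (simplicial c S T) b = 0" using s that(1) by blast
      qed
      finally show ?thesis by (simp add: act_def)
    qed
    then show ?thesis by blast
  qed blast
  then obtain s0 where s0: "\<And>S T s' a. s0 S T \<le> s' \<Longrightarrow> S \<subseteq> J \<Longrightarrow> card S = p \<Longrightarrow> T \<notin> \<Delta> \<Longrightarrow>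
      \<forall>i\<in>T. a i < 0 \<Longrightarrow> transit s' (simplicial c) S T a = 0"
    by metis
  \<comment> \<open>One exponent for all of the finitely many components.\<close>
  define s where "s = Max ((\<lambda>(S, T). s0 S T) ` (Pow J \<times> UNIV))"
  have s: "s0 S T \<le> s" if "S \<subseteq> J" for S T
  proof -
    have "s0 S T \<in> (\<lambda>(S, T). s0 S T) ` (Pow J \<times> UNIV)" using that by force
    then show ?thesis unfolding s_def using finite_J by (intro Max_ge) auto
  qed
  define c' where "c' = transit s c"
  have c': "simplicial c' S T a = 0" if "S \<subseteq> J" "card S = p" "card T = Suc (Suc q)" "\<forall>i\<in>T. a i < 0" for S T a
  proof (cases "T \<in> \<Delta>")
    case True
    have "eq_at p (Suc (Suc q)) (transit s (simplicial c)) (transit s zero_c)" using assms(2) by (rule eq_at_transit)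
    moreover have "transit s zero_c S T a = 0" by (simp add: transit_def act_def)
    ultimately show ?thesis
      using that True by (simp add: c'_def eq_at_def flip: transit_simplicial)
  next
    case False
    show ?thesis unfolding c'_def transit_simplicial[symmetric]
      by (rule s0[of S T]) (use that False s in auto)
  qed
  \<comment> \<open>Contracting at an index that depends on the exponent keeps a component bounded below, as it is a finite sum over the possible indices.\<close>
  define neg where "neg a = (SOME i. a i < 0)" for a :: "'n \<Rightarrow> int"
  define \<eta> where "\<eta> S T a = contraction e (neg a) (c' S) T a" for S T a
  have bc': "bounded_c c'" unfolding c'_def by (rule bounded_c_transit[OF assms(1)])
  have "bounded_below (\<eta> S T)" for S T
  proof -
    have "bounded_below (\<lambda>a. \<Sum>i\<in>UNIV. (if neg a = i \<and> i \<notin> T then sgn_in e i T else 0) * c' S (insert i T) a)"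
      using bc' by (intro bounded_below_sum bounded_below_scale) (simp add: bounded_c_def)
    moreover have "(\<Sum>i\<in>UNIV. (if neg a = i \<and> i \<notin> T then sgn_in e i T else 0) * c' S (insert i T) a) = \<eta> S T a" for a
    proof -
      have "(\<Sum>i\<in>UNIV. (if neg a = i \<and> i \<notin> T then sgn_in e i T else 0) * c' S (insert i T) a)
          = (\<Sum>i\<in>UNIV. if neg a = i then \<eta> S T a else 0)"
        by (rule sum.cong) (auto simp: \<eta>_def contraction_def)
      then show ?thesis by simp
    qed
    ultimately show ?thesis by simp
  qed
  then have "bounded_c \<eta>" by (simp add: bounded_c_def)
  moreover have "eq_at p (Suc q) c' (simplicial \<eta>)"
    unfolding eq_at_def
  proof (intro allI impI)
    fix S T and a :: "'n \<Rightarrow> int"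
    assume *: "S \<subseteq> J" "card S = p" "T \<in> \<Delta>" "card T = Suc q" "\<forall>i\<in>T. a i < 0"
    then have "T \<noteq> {}" by auto
    then have i: "a (neg a) < 0" unfolding neg_def using *(5) by (intro someI_ex[of "\<lambda>i. a i < 0"]) blast
    have "contraction e (neg a) (simplicial c' S) T a = 0"
    proof (cases "neg a \<in> T")
      case False
      have "simplicial c' S (insert (neg a) T) a = 0" by (rule c') (use * i False in auto)
      then show ?thesis by (simp add: contraction_def)
    qed (simp add: contraction_def)
    moreover have "coboundary e (\<lambda>i v. v) (contraction e (neg a) (c' S)) T a = simplicial \<eta> S T a"
      unfolding simplicial_def coboundary_def \<eta>_def ..
    moreover have "contraction e (neg a) (simplicial c' S) = contraction e (neg a) (coboundary e (\<lambda>i v. v) (c' S))"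
      unfolding simplicial_def ..
    ultimately show "c' S T a = simplicial \<eta> S T a"
      using coboundary_contraction[OF finite inj_e linear_id, of "neg a" "c' S" T a] by simp
  qed
  ultimately show ?thesis unfolding c'_def by blast
qed

text \<open>Diagram chase by descending induction on \<open>p\<close>, trivial for \<open>p > card J\<close>. Up to a transition, \<open>c\<close> is
the simplicial coboundary of some \<open>\<eta>\<close>; the Koszul coboundary of \<open>\<eta>\<close> satisfies the hypotheses in
bidegree \<open>(p + 1, q - 1)\<close>, so after a further transition it is the Koszul coboundary of some
\<open>simplicial \<theta>'\<close>. By \<open>koszul_exact\<close> the difference of \<open>\<eta>\<close> and \<open>simplicial \<theta>'\<close> is a Koszul coboundary, and
applying \<open>simplicial\<close> removes the term with \<open>\<theta>'\<close>.\<close>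

lemma descent:
  assumes "1 \<le> p" "card J < p + q" "bounded_c c"
    and "eq_at p (Suc q) (simplicial c) zero_c" "eq_at (Suc p) q (koszul t c) zero_c"
  shows "\<exists>s \<theta>. bounded_c \<theta> \<and> eq_at p q (transit s c) (koszul (t + s) (simplicial \<theta>))"
  using assms
proof (induction "Suc (card J) - p" arbitrary: p q c t)
  case 0
  have "card S \<noteq> p" if "S \<subseteq> J" for S
    using 0(1) card_mono[OF finite_J that] by linarith
  then have "eq_at p q (transit 0 c) (koszul (t + 0) (simplicial zero_c))"
    by (auto simp: eq_at_def)
  moreover have "bounded_c zero_c" by (simp add: bounded_c_def bounded_below_zero)
  ultimately show ?case by blast
next
  case (Suc x)
  have "q \<noteq> 0" using Suc.hyps(2) Suc.prems(2) by linarith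
  then obtain q' where q: "q = Suc q'" by (cases q) auto
  have fin: "finite S" if "S \<subseteq> J" for S using that finite_J finite_subset by blast
  obtain s \<eta> where \<eta>: "bounded_c \<eta>" "eq_at p q (transit s c) (simplicial \<eta>)"
    using simplicial_exact[OF Suc.prems(3) _ Suc.prems(1), of q'] Suc.prems(4) q by blast
  let ?c = "koszul (t + s) \<eta>"
  have "eq_at (Suc p) q (simplicial ?c) (koszul (t + s) (transit s c))"
    unfolding koszul_simplicial[symmetric] by (rule eq_at_koszul[OF eq_at_sym[OF \<eta>(2)]])
  also have "eq_at (Suc p) q \<dots> (transit s (koszul t c))"
    using fin by (simp add: eq_at_def transit_koszul)
  also have "eq_at (Suc p) q \<dots> (transit s zero_c)" by (rule eq_at_transit[OF Suc.prems(5)])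
  finally have 1: "eq_at (Suc p) (Suc q') (simplicial ?c) zero_c"
    by (simp add: q transit_def act_def)
  have 2: "eq_at (Suc (Suc p)) q' (koszul (t + s) ?c) zero_c"
    using fin by (simp add: eq_at_def koszul_koszul)
  have "x = Suc (card J) - Suc p" using Suc.hyps(2) by simp
  then obtain s' \<theta>' where \<theta>': "bounded_c \<theta>'"
      "eq_at (Suc p) q' (transit s' ?c) (koszul (t + s + s') (simplicial \<theta>'))"
    using Suc.hyps(1)[of "Suc p" q' ?c "t + s"] 1 2 Suc.prems q bounded_c_koszul[OF \<eta>(1)] by auto
  have "eq_at (Suc p) q' (koszul (t + s + s') (transit s' \<eta>)) (transit s' ?c)"
    using fin by (simp add: eq_at_def transit_koszul)
  then have "eq_at (Suc p) q' (koszul (t + s + s') (transit s' \<eta>)) (koszul (t + s + s') (simplicial \<theta>'))"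
    using \<theta>'(2) by (rule eq_at_trans)
  then have "eq_at (Suc p) q' (koszul (t + s + s') (minus_c (transit s' \<eta>) (simplicial \<theta>'))) zero_c"
    unfolding koszul_minus by (simp only: eq_at_minus)
  then obtain \<theta> where \<theta>: "bounded_c \<theta>"
      "eq_at p q' (minus_c (transit s' \<eta>) (simplicial \<theta>')) (koszul (t + s + s') \<theta>)"
    using koszul_exact bounded_c_minus[OF bounded_c_transit[OF \<eta>(1)] bounded_c_simplicial[OF \<theta>'(1)]] by blast
  have "transit (s + s') c S T = transit s' (transit s c) S T" for S T
    by (simp add: transit_def power_add prod.distrib act_mult) (rule act_commute)
  then have "eq_at p q (transit (s + s') c) (transit s' (transit s c))" by (simp add: eq_at_def)
  also have "eq_at p q \<dots> (transit s' (simplicial \<eta>))" by (rule eq_at_transit[OF \<eta>(2)])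
  also have "eq_at p q \<dots> (simplicial (plus_c (simplicial \<theta>') (koszul (t + s + s') \<theta>)))"
    unfolding transit_simplicial q by (rule eq_at_simplicial[OF eq_at_minus_plus[OF \<theta>(2)]])
  also have "eq_at p q \<dots> (simplicial (koszul (t + s + s') \<theta>))"
    unfolding simplicial_plus by (simp add: eq_at_def plus_c_def simplicial_simplicial)
  finally have "eq_at p q (transit (s + s') c) (koszul (t + (s + s')) (simplicial \<theta>))"
    by (simp only: koszul_simplicial add.assoc)
  then show ?case using \<theta>(1) by blast
qed

text \<open>Place \<open>\<omega>\<close> at \<open>S = {}\<close> and at the exponent \<open>-1\<close> in every variable, as multiples of
\<open>1 / (x\<^sub>1 ... x\<^sub>n)\<close>. Its Koszul coboundary is a simplicial cocycle because \<open>\<Delta>\<close> has no sets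
with more than \<open>N\<close> elements, so \<open>descent\<close> applies, and Koszul exactness in degree
zero turns the result into an identity for \<open>\<omega>\<close>
itself.\<close>

lemma top_cochain_is_coboundary:
  fixes \<omega> :: "'n set \<Rightarrow> 'k"
  assumes top: "\<And>T. T \<in> \<Delta> \<Longrightarrow> card T \<le> N" and few: "card J \<le> N"
  shows "\<exists>g. \<forall>T\<in>\<Delta>. card T = N \<longrightarrow> \<omega> T = (\<Sum>i\<in>T. sgn_in e i T * g (T - {i}))"
proof -
  define c where "c S T a = (if S = {} \<and> a = (\<lambda>i. - 1) then \<omega> T else 0)" 
    for S :: "nat set" and T and a :: "'n \<Rightarrow> int"
  have bc: "bounded_c c"
    unfolding bounded_c_def bounded_below_def c_def by (intro allI exI[of _ "- 1"]) auto
  have fin: "finite S" if "S \<subseteq> J" for S using that finite_J finite_subset by blast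
  have "eq_at 1 (Suc N) (simplicial (koszul 1 c)) zero_c"
    unfolding eq_at_def
  proof (intro allI impI)
    fix S T a assume "T \<in> \<Delta>" "card T = Suc N"
    then show "simplicial (koszul 1 c) S T a = 0" using top[of T] by simp
  qed
  moreover have "eq_at (Suc 1) N (koszul 1 (koszul 1 c)) zero_c"
    using fin by (simp add: eq_at_def koszul_koszul)
  ultimately obtain s \<theta> where \<theta>: "bounded_c \<theta>"
      "eq_at 1 N (transit s (koszul 1 c)) (koszul (1 + s) (simplicial \<theta>))"
    using descent[of 1 N "koszul 1 c" 1] few bounded_c_koszul[OF bc] by auto
  have "eq_at 1 N (koszul (1 + s) (transit s c)) (transit s (koszul 1 c))"
    unfolding eq_at_def using transit_koszul[OF fin, where t = 1 and s = s and c = c] by simp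
  then have "eq_at 1 N (koszul (1 + s) (transit s c)) (koszul (1 + s) (simplicial \<theta>))"
    using \<theta>(2) by (rule eq_at_trans)
  then have "eq_at (Suc 0) N (koszul (1 + s) (minus_c (transit s c) (simplicial \<theta>))) zero_c"
    unfolding koszul_minus by (simp only: eq_at_minus One_nat_def)
  then obtain \<xi> where \<xi>: "eq_at 0 N (minus_c (transit s c) (simplicial \<theta>)) (koszul (1 + s) \<xi>)"
    using koszul_exact bounded_c_minus[OF bounded_c_transit[OF bc] bounded_c_simplicial[OF \<theta>(1)]] by blast
  have "\<omega> T = (\<Sum>i\<in>T. sgn_in e i T * \<theta> {} (T - {i}) (\<lambda>i. - 1))" if "T \<in> \<Delta>" "card T = N" for T
  proof -
    have "minus_c (transit s c) (simplicial \<theta>) {} T (\<lambda>i. - 1) = koszul (1 + s) \<xi> {} T (\<lambda>i. - 1)"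
      using \<xi> that by (simp add: eq_at_def)
    then show ?thesis
      by (simp add: minus_c_def transit_def koszul_def simplicial_def coboundary_def c_def)
  qed
  then show ?thesis by (intro exI[of _ "\<lambda>T. \<theta> {} T (\<lambda>i. - 1)"]) blast
qed

end

section \<open>A cycle on the complements of transversals\<close>

text \<open>The colour classes are intervals in the order given by \<open>e\<close>. Hence no element of a
transversal \<open>X\<close> lies strictly between \<open>i\<close> and the element \<open>b\<close> of the same colour, and the two are
neighbours in \<open>insert i X\<close>.\<close>

lemma adjacent_sgn:
  fixes e :: "'n::finite \<Rightarrow> nat" and \<beta> :: "'n \<Rightarrow> 'n"
  assumes e: "inj e" "\<And>i j. e i \<le> e j \<Longrightarrow> e (\<beta> i) \<le> e (\<beta> j)"
    and X: "inj_on \<beta> X" "i \<notin> X" "b \<in> X" "\<beta> i = \<beta> b" "e i < e b"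
  shows "sgn_in e b (insert i (X - {b})) = - (sgn_in e i X :: 'k::comm_ring_1)"
proof -
  have "e x < e i" if "x \<in> X" "x \<noteq> b" "e x < e b" for x
  proof (rule ccontr)
    assume "\<not> e x < e i"
    then have "e (\<beta> i) \<le> e (\<beta> x)" "e (\<beta> x) \<le> e (\<beta> b)" using e(2) that by simp_all
    then have "\<beta> x = \<beta> b" using X(4) e(1) by (simp add: injD)
    then show False using X(1,3) that by (auto dest: inj_onD)
  qed
  then have "{x \<in> insert i (X - {b}). e x < e b} = insert i {x \<in> X. e x < e i}"
    using X by auto
  moreover have "i \<notin> {x \<in> X. e x < e i}" by simp
  ultimately show ?thesis by (simp add: sgn_in_def)
qed

text \<open>Pair the coboundary of \<open>g\<close> with the chain of all complements of transversals \<open>C\<close>, weighted by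
\<open>\<Prod>x\<in>C. \<sigma> x\<close>. The result is a sum over pairs \<open>(C, i)\<close> with \<open>i \<notin> C\<close>, and exchanging \<open>i\<close>
with the element of \<open>C\<close> of the same colour is an involution that preserves \<open>insert i C\<close> and flips
the sign. So the sum is zero, while the indicator function of \<open>B0\<close> pairs to a unit.\<close>

lemma transversal_complements_carry_cycle:
  fixes e :: "'n::finite \<Rightarrow> nat" and \<beta> :: "'n \<Rightarrow> 'n" and g :: "'n set \<Rightarrow> 'k::field"
  assumes e: "inj e" "\<And>i j. e i \<le> e j \<Longrightarrow> e (\<beta> i) \<le> e (\<beta> j)"
    and B0: "range \<beta> = B0" "\<And>b. b \<in> B0 \<Longrightarrow> \<beta> b = b"
  shows "\<exists>C. bij_betw \<beta> C B0 \<and>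
    (if C = B0 then 1 else 0) \<noteq> (\<Sum>i\<in>-C. sgn_in e i (- C) * g (- C - {i}))"
proof (rule ccontr)
  assume "\<not> ?thesis"
  then have eq: "(\<Sum>i\<in>-C. sgn_in e i (- C) * g (- C - {i})) = (if C = B0 then 1 else 0)"
    if "bij_betw \<beta> C B0" for C using that by metis
  define Tr where "Tr = {C. bij_betw \<beta> C B0}"
  \<comment> \<open>The sign \<open>\<sigma> i\<close> compares the position of \<open>i\<close> in a set with its position in the complement.\<close>
  define \<sigma> where "\<sigma> i = (sgn_in e i UNIV :: 'k)" for i
  have sq: "sgn_in e i S * sgn_in e i S = (1 :: 'k)" for i S by (rule sgn_in_square)
  have split: "sgn_in e i (- C) = \<sigma> i * sgn_in e i C" for i C
  proof -
    have "{j. e j < e i} = {j \<in> C. e j < e i} \<union> {j \<in> - C. e j < e i}" by auto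
    then have "card {j. e j < e i} = card {j \<in> C. e j < e i} + card {j \<in> - C. e j < e i}"
      by (simp only: card_Un_disjnt[symmetric] finite disjnt_def) (rule card_Un_disjoint, auto)
    then have "\<sigma> i = sgn_in e i C * sgn_in e i (- C)"
      by (simp add: \<sigma>_def sgn_in_def power_add)
    then have "\<sigma> i * sgn_in e i C = sgn_in e i (- C) * (sgn_in e i C * sgn_in e i C)"
      by (simp only: mult.assoc mult.commute mult.left_commute)
    then show ?thesis by (simp only: sq mult_1_right)
  qed
  define H where "H X = (\<Prod>x\<in>X. \<sigma> x) * g (- X)" for X
  define F where "F = (\<lambda>(C, i). sgn_in e i C * H (insert i C))"
  define mate where "mate C i = inv_into C \<beta> (\<beta> i)" for C i
  define swap where "swap = (\<lambda>(C, i). (insert i (C - {mate C i}), mate C i))"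
  define P where "P = Sigma Tr (\<lambda>C. - C)"
  have mate: "mate C i \<in> C" "\<beta> (mate C i) = \<beta> i" if "C \<in> Tr" for C i
  proof -
    have "\<beta> i \<in> \<beta> ` C" using that B0(1) by (auto simp: Tr_def bij_betw_def)
    then show "mate C i \<in> C" "\<beta> (mate C i) = \<beta> i"
      unfolding mate_def by (rule inv_into_into, rule f_inv_into_f)
  qed
  have mate_eq: "mate C i = b" if "C \<in> Tr" "b \<in> C" "\<beta> b = \<beta> i" for C i b
    unfolding mate_def using that by (metis Tr_def bij_betw_def inv_into_f_f mem_Collect_eq)
  have swap: "swap (C, i) \<in> P \<and> swap (swap (C, i)) = (C, i) \<and>
      mate (insert i (C - {mate C i})) (mate C i) = i" if "(C, i) \<in> P" for C i
  proof -
    have C: "C \<in> Tr" "i \<notin> C" using that by (auto simp: P_def)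
    let ?b = "mate C i" and ?C = "insert i (C - {mate C i})"
    have b: "?b \<in> C" "\<beta> ?b = \<beta> i" using mate[OF C(1)] by auto
    have inj: "inj_on \<beta> C" and im: "\<beta> ` C = B0" using C(1) by (auto simp: Tr_def bij_betw_def)
    have "\<beta> x \<noteq> \<beta> i" if "x \<in> C - {?b}" for x
      using inj_onD[OF inj, of x ?b] that b by auto
    moreover have "inj_on \<beta> (C - {?b})" using inj by (rule inj_on_diff)
    moreover have "C - {?b} - {i} = C - {?b}" using C by auto
    ultimately have "inj_on \<beta> ?C" unfolding inj_on_insert by (metis imageE)
    moreover have "\<beta> ` ?C = B0"
    proof -
      have "\<beta> ` ?C = insert (\<beta> ?b) (\<beta> ` (C - {?b}))" using b by simp
      also have "\<dots> = \<beta> ` insert ?b (C - {?b})" by (rule image_insert[symmetric])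
      also have "insert ?b (C - {?b}) = C" using b by auto
      finally show ?thesis using im by simp
    qed
    ultimately have C': "?C \<in> Tr" by (simp add: Tr_def bij_betw_def)
    moreover have "?b \<notin> ?C" using b C by auto
    moreover have m: "mate ?C ?b = i" by (rule mate_eq[OF C']) (use b in auto)
    moreover have "insert ?b (?C - {i}) = C" using b C by auto
    ultimately show ?thesis by (simp add: swap_def P_def m)
  qed
  \<comment> \<open>Cancelling one half of the pairs against the other, rather than showing that the sum is its own negative, also works in characteristic two.\<close>
  define P1 where "P1 = {(C, i) \<in> P. e i < e (mate C i)}"
  define P2 where "P2 = {(C, i) \<in> P. e (mate C i) < e i}"
  have "sum F P1 = (\<Sum>p\<in>P2. - F p)"
  proof (rule sum.reindex_bij_witness[of P1 swap swap])
    fix p assume p: "p \<in> P1"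
    then obtain C i where Ci: "p = (C, i)" "(C, i) \<in> P" "e i < e (mate C i)" by (auto simp: P1_def)
    then have C: "C \<in> Tr" "i \<notin> C" by (auto simp: P_def)
    show "swap (swap p) = p" "swap p \<in> P2"
      using swap[OF Ci(2)] Ci by (auto simp: P2_def swap_def)
    have b: "mate C i \<in> C" "\<beta> (mate C i) = \<beta> i" using mate[OF C(1)] by auto
    have "sgn_in e (mate C i) (insert i (C - {mate C i})) = - (sgn_in e i C :: 'k)"
      using C b Ci(3) by (intro adjacent_sgn[where \<beta> = \<beta>, OF e]) (auto simp: Tr_def bij_betw_def)
    moreover have "insert (mate C i) (insert i (C - {mate C i})) = insert i C" using b by auto
    ultimately show "- F (swap p) = F p" by (simp add: Ci(1) F_def swap_def)
  next
    fix p assume "p \<in> P2"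
    then obtain C i where Ci: "p = (C, i)" "(C, i) \<in> P" "e (mate C i) < e i" by (auto simp: P2_def)
    show "swap (swap p) = p" "swap p \<in> P1"
      using swap[OF Ci(2)] Ci by (auto simp: P1_def swap_def)
  qed
  moreover have "P = P1 \<union> P2" "P1 \<inter> P2 = {}"
  proof -
    have "e i \<noteq> e (mate C i)" if "(C, i) \<in> P" for C i
      using mate(1)[of C i] that e(1) by (auto simp: P_def dest: injD)
    then show "P = P1 \<union> P2" by (fastforce simp: P1_def P2_def neq_iff)
    show "P1 \<inter> P2 = {}" by (auto simp: P1_def P2_def)
  qed
  moreover have finP: "finite P" by (rule finite)
  ultimately have "sum F P = 0"
    by (simp add: sum.union_disjoint finite_subset sum_negf)
  also have "sum F P = (\<Sum>C\<in>Tr. \<Sum>i\<in>-C. F (C, i))"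
    unfolding P_def by (subst sum.Sigma) auto
  also have "\<dots> = (\<Sum>C\<in>Tr. (\<Prod>x\<in>C. \<sigma> x) * (\<Sum>i\<in>-C. sgn_in e i (- C) * g (- C - {i})))"
    unfolding sum_distrib_left
  proof (intro sum.cong refl)
    fix C :: "'n set" and i assume "i \<in> - C"
    then have "i \<notin> C" "- C - {i} = - insert i C" by auto
    then show "F (C, i) = prod \<sigma> C * (sgn_in e i (- C) * g (- C - {i}))"
      by (simp add: F_def H_def split)
  qed
  also have "\<dots> = (\<Sum>C\<in>Tr. if C = B0 then (\<Prod>x\<in>C. \<sigma> x) else 0)"
    by (rule sum.cong) (simp_all add: eq Tr_def)
  also have "\<dots> = (\<Prod>x\<in>B0. \<sigma> x)"
  proof -
    have "B0 \<in> Tr" using B0(2) by (auto simp: Tr_def bij_betw_def inj_on_def image_iff)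
    then show ?thesis by simp
  qed
  finally have "(\<Prod>x\<in>B0. \<sigma> x) = 0" .
  then obtain x where "\<sigma> x = 0" by auto
  then show False using sq[of x UNIV] by (simp add: \<sigma>_def)
qed

section \<open>Square-free monomials\<close>

definition sqf :: "'n::finite set \<Rightarrow> 'n mon"
  where "sqf A = (\<Sum>i\<in>A. Poly_Mapping.single i 1)"

lemma lookup_sqf [simp]: "Poly_Mapping.lookup (sqf A) i = (if i \<in> A then 1 else 0)"
  by (simp add: sqf_def lookup_sum lookup_single when_def)

lemma keys_sqf [simp]: "Poly_Mapping.keys (sqf A) = A"
  by (auto simp: in_keys_iff split: if_splits)

lemma sqf_inject [simp]: "sqf A = sqf B \<longleftrightarrow> A = B"
  by (metis keys_sqf)

lemma mon_deg_sqf [simp]: "mon_deg (sqf A) = card A"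
  by (simp add: mon_deg_def sum.If_cases)

lemma sqf_keys:
  assumes "squarefree_mon u"
  shows "sqf (Poly_Mapping.keys u) = u"
proof (rule poly_mapping_eqI)
  fix i
  have "Poly_Mapping.lookup u i \<le> 1" using assms by (simp add: squarefree_mon_def)
  then show "Poly_Mapping.lookup (sqf (Poly_Mapping.keys u)) i = Poly_Mapping.lookup u i"
    using in_keys_iff[of i u] by (cases "Poly_Mapping.lookup u i = 0") auto
qed

lemma sqf_dvd_iff: "(\<exists>w. sqf A = w + sqf B) \<longleftrightarrow> B \<subseteq> A"
proof
  assume "\<exists>w. sqf A = w + sqf B"
  then obtain w where w: "sqf A = w + sqf B" by blast
  show "B \<subseteq> A"
  proof
    fix i assume "i \<in> B"
    then show "i \<in> A" using arg_cong[OF w, of "\<lambda>u. Poly_Mapping.lookup u i"] by (auto simp: lookup_add split: if_splits)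
  qed
next
  assume "B \<subseteq> A"
  then have "sqf A = sqf (A - B) + sqf B"
    by (intro poly_mapping_eqI) (auto simp: lookup_add)
  then show "\<exists>w. sqf A = w + sqf B" by blast
qed

lemma mono_poly_power:
  "\<exists>w. mono_poly u ^ r = (mono_poly w :: ('n, 'k::field) mpol) \<and>
    (\<forall>i. Poly_Mapping.lookup u i = 0 \<longrightarrow> Poly_Mapping.lookup w i = 0)"
proof (induction r)
  case 0
  show ?case by (intro exI[of _ 0]) (simp flip: single_one)
next
  case (Suc r)
  then obtain w where "mono_poly u ^ r = (mono_poly w :: ('n, 'k) mpol)"
    "\<forall>i. Poly_Mapping.lookup u i = 0 \<longrightarrow> Poly_Mapping.lookup w i = 0" by blast
  then show ?case by (intro exI[of _ "u + w"]) (simp add: mult_single lookup_add)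
qed

abbreviation basis_ideal :: "'n::finite set set \<Rightarrow> ('n, 'k::field) mpol set"
  where "basis_ideal \<B> \<equiv> ideal_gen (mono_poly ` sqf ` \<B>)"

lemma mono_poly_sqf_in_basis_ideal:
  "mono_poly (sqf A) \<in> (basis_ideal \<B> :: ('n::finite, 'k::field) mpol set) \<longleftrightarrow> (\<exists>B\<in>\<B>. B \<subseteq> A)"
  by (auto simp: mono_poly_in_ideal_iff sqf_dvd_iff)

section \<open>The lower bound\<close>

context loopless_matroid
begin

text \<open>Reordering the variables by colour first makes the colour classes intervals, as
\<open>adjacent_sgn\<close> requires.\<close>

lemma contiguous_coloring:
  "\<exists>B0\<in>\<B>. \<exists>(\<beta> :: 'n \<Rightarrow> 'n) e :: 'n \<Rightarrow> nat. range \<beta> = B0 \<and> (\<forall>b\<in>B0. \<beta> b = b) \<and>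
    (\<forall>C. bij_betw \<beta> C B0 \<longrightarrow> C \<in> \<B>) \<and> inj e \<and> (\<forall>i j. e i \<le> e j \<longrightarrow> e (\<beta> i) \<le> e (\<beta> j))"
proof -
  obtain e0 :: "'n \<Rightarrow> nat" and M where e0: "inj e0" "range e0 = {i. i < M}"
    using finite_imp_inj_to_nat_seg[OF finite, of "UNIV :: 'n set"] by auto
  obtain B0 \<beta> where \<beta>: "B0 \<in> \<B>" "\<forall>b\<in>B0. \<beta> b = b" "range \<beta> = B0" "\<forall>C. bij_betw \<beta> C B0 \<longrightarrow> C \<in> \<B>"
    using transversal_coloring[OF e0(1)] by blast
  have M: "e0 i < M" for i using e0(2) by blast
  \<comment> \<open>The colour is the leading digit in base \<open>M\<close>.\<close>
  define e where "e i = e0 (\<beta> i) * M + e0 i" for i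
  have div: "e i div M = e0 (\<beta> i)" and mod: "e i mod M = e0 i" for i
    using M[of i] by (simp_all add: e_def)
  have "inj e" using e0(1) mod by (metis injD injI)
  moreover have "e (\<beta> i) \<le> e (\<beta> j)" if "e i \<le> e j" for i j
  proof -
    have "\<beta> (\<beta> i) = \<beta> i" "\<beta> (\<beta> j) = \<beta> j" using \<beta> by auto
    moreover have "e0 (\<beta> i) \<le> e0 (\<beta> j)" using div_le_mono[OF that, of M] by (simp only: div)
    ultimately show ?thesis by (simp add: e_def add_mono)
  qed
  ultimately show ?thesis using \<beta> by blast
qed

text \<open>With at most \<open>n - d\<close> generators, the indicator function of the complement of \<open>B0\<close> would be a
coboundary on the complex \<open>\<Delta>\<close> of sets disjoint from a basis, against the cycle of complements of
transversals. The two module hypotheses of \<open>double_complex\<close> express the two inclusions between the radicals.\<close>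

theorem radical_generators_lower_bound:
  fixes f :: "nat \<Rightarrow> ('n, 'k::field) mpol"
  assumes rad: "ideal_radical (ideal_gen (f ` {1..m})) = ideal_radical (basis_ideal \<B>)"
  shows "CARD('n) - d < m"
proof (rule ccontr)
  assume "\<not> ?thesis"
  then have few: "card {1..m} \<le> CARD('n) - d" by simp
  obtain B0 \<beta> and e :: "'n \<Rightarrow> nat" where B0: "B0 \<in> \<B>" "range \<beta> = B0" "\<And>b. b \<in> B0 \<Longrightarrow> \<beta> b = b"
      "\<And>C. bij_betw \<beta> C B0 \<Longrightarrow> C \<in> \<B>" and e: "inj e" "\<And>i j. e i \<le> e j \<Longrightarrow> e (\<beta> i) \<le> e (\<beta> j)"
    using contiguous_coloring by blast
  define \<Delta> where "\<Delta> = {T :: 'n set. \<exists>B\<in>\<B>. B \<inter> T = {}}"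
  interpret double_complex e f "{1..m}" \<Delta>
  proof
    show "T' \<in> \<Delta>" if "T \<in> \<Delta>" "T' \<subseteq> T" for T T' using that unfolding \<Delta>_def by blast
    show "\<exists>w a. (\<forall>i\<in>T. Poly_Mapping.lookup w i = 0) \<and> mono_poly w = (\<Sum>j\<in>{1..m}. a j * f j ^ t)"
      if T: "T \<in> \<Delta>" for T t
    proof -
      obtain B where B: "B \<in> \<B>" "B \<inter> T = {}" using T unfolding \<Delta>_def by blast
      have "mono_poly (sqf B) \<in> (basis_ideal \<B> :: ('n, 'k) mpol set)"
        using B(1) by (intro ring_module.span_base) auto
      then have "mono_poly (sqf B) \<in> ideal_radical (ideal_gen (f ` {1..m}))"
        using subset_ideal_radical rad by blast
      then obtain k where "mono_poly (sqf B) ^ k \<in> ideal_gen (f ` {1..m})"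
        by (auto simp: ideal_radical_def)
      then obtain r where "(mono_poly (sqf B) ^ k) ^ r \<in> ideal_gen ((\<lambda>j. f j ^ t) ` {1..m})"
        using power_in_ideal_gen_powers by blast
      then obtain a where a: "mono_poly (sqf B) ^ (k * r) = (\<Sum>j\<in>{1..m}. a j * f j ^ t)"
        using ideal_gen_image_sum[of _ "\<lambda>j. f j ^ t" "{1..m}"] by (auto simp: power_mult)
      obtain w where w: "mono_poly (sqf B) ^ (k * r) = (mono_poly w :: ('n, 'k) mpol)"
          "\<And>i. Poly_Mapping.lookup (sqf B) i = 0 \<Longrightarrow> Poly_Mapping.lookup w i = 0"
        using mono_poly_power[of "sqf B" "k * r"] by blast
      have "Poly_Mapping.lookup w i = 0" if "i \<in> T" for i
        by (rule w(2)) (use that B(2) in auto)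
      then show ?thesis using a w(1) by (intro exI[of _ w] exI[of _ a]) simp
    qed
    show "\<exists>k. \<forall>u\<in>Poly_Mapping.keys (f j ^ k). \<exists>i\<in>T. Poly_Mapping.lookup u i \<noteq> 0"
      if "T \<notin> \<Delta>" "j \<in> {1..m}" for T j
    proof -
      have "f j \<in> ideal_gen (f ` {1..m})" using that(2) by (intro ring_module.span_base) auto
      then have "f j \<in> ideal_radical (basis_ideal \<B>)" using subset_ideal_radical rad by blast
      then obtain k where k: "f j ^ k \<in> basis_ideal \<B>" by (auto simp: ideal_radical_def)
      have "\<exists>i\<in>T. Poly_Mapping.lookup u i \<noteq> 0" if u: "u \<in> Poly_Mapping.keys (f j ^ k)" for u
      proof -
        obtain v w where "v \<in> sqf ` \<B>" "u = w + v" using keys_mono_poly_ideal[OF k u] by blast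
        then obtain B where B: "B \<in> \<B>" "u = w + sqf B" by blast
        then obtain i where "i \<in> B" "i \<in> T" using \<open>T \<notin> \<Delta>\<close> by (auto simp: \<Delta>_def)
        then show ?thesis using B(2) by (intro bexI[of _ i]) (simp_all add: lookup_add)
      qed
      then show ?thesis by blast
    qed
  qed (use e in auto)
  have co: "card (- B) = CARD('n) - d" if "B \<in> \<B>" for B
    using card_basis[OF that] by (simp add: Compl_eq_Diff_UNIV card_Diff_subset)
  have "card T \<le> CARD('n) - d" if T: "T \<in> \<Delta>" for T
  proof -
    obtain B where B: "B \<in> \<B>" "T \<subseteq> - B" using T unfolding \<Delta>_def by blast
    then show ?thesis using card_mono[OF finite B(2)] co[OF B(1)] by simp
  qed
  from top_cochain_is_coboundary[OF this few, of "\<lambda>T. if - T = B0 then 1 else 0"]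
  obtain g where g: "\<And>T. T \<in> \<Delta> \<Longrightarrow> card T = CARD('n) - d \<Longrightarrow>
      (if - T = B0 then 1 else 0) = (\<Sum>i\<in>T. sgn_in e i T * (g (T - {i}) :: 'k))"
    by blast
  obtain C where C: "bij_betw \<beta> C B0"
      "(if C = B0 then 1 else 0) \<noteq> (\<Sum>i\<in>-C. sgn_in e i (- C) * (g (- C - {i}) :: 'k))"
    using transversal_complements_carry_cycle[of e \<beta> B0 g] e B0 by blast
  have "- C \<in> \<Delta>" using B0(4)[OF C(1)] by (auto simp: \<Delta>_def)
  from g[OF this co[OF B0(4)[OF C(1)]]] C(2) show False by simp
qed

section \<open>The upper bound\<close>

text \<open>The generators are the sums of all square-free monomials of equal degree in the ideal, with degrees
\<open>d, ..., n\<close>. Multiplying such a sum by one of its terms \<open>p X\<close> gives \<open>p X ^ 2\<close> plus products divisible by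
\<open>p (X \<union> Y)\<close>, which has higher degree and is in the radical by induction.\<close>

theorem radical_generators_upper_bound:
  "\<exists>f :: nat \<Rightarrow> ('n, 'k::field) mpol.
    ideal_radical (ideal_gen (f ` {1..CARD('n) - d + 1})) = ideal_radical (basis_ideal \<B>)"
proof -
  define spanning where "spanning = {X. \<exists>B\<in>\<B>. B \<subseteq> X}"
  define p where "p X = (mono_poly (sqf X) :: ('n, 'k) mpol)" for X
  \<comment> \<open>The degree is \<open>d + k - 1\<close>, written without subtraction.\<close>
  define f where "f k = (\<Sum>X | X \<in> spanning \<and> Suc (card X) = d + k. p X)" for k
  let ?A = "ideal_gen (f ` {1..CARD('n) - d + 1})" and ?I = "basis_ideal \<B> :: ('n, 'k) mpol set"
  have p_in: "p X \<in> ?I" if "X \<in> spanning" for X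
    using that by (simp add: p_def mono_poly_sqf_in_basis_ideal spanning_def)
  have "f k \<in> ?I" for k
    unfolding f_def by (rule ring_module.span_sum) (use p_in in auto)
  then have "?A \<subseteq> ?I"
    by (intro ring_module.span_minimal) auto
  then have le: "ideal_radical ?A \<subseteq> ideal_radical ?I"
    by (auto simp: ideal_radical_def)
  have idl: "is_ideal (ideal_radical ?A)" by (intro is_ideal_radical) simp
  have p_mult: "p X * p Y = p (X \<inter> Y) * p (X \<union> Y)" for X Y
  proof -
    have "sqf X + sqf Y = sqf (X \<inter> Y) + sqf (X \<union> Y)"
      by (intro poly_mapping_eqI) (simp add: lookup_add)
    then show ?thesis by (simp add: p_def mult_single)
  qed
  have rad: "p X \<in> ideal_radical ?A" if "X \<in> spanning" for X
    using that
  proof (induction "CARD('n) - card X" arbitrary: X rule: less_induct)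
    case less
    obtain B where B: "B \<in> \<B>" "B \<subseteq> X" using less.prems by (auto simp: spanning_def)
    have X: "d \<le> card X" "card X \<le> CARD('n)"
      using card_mono[OF finite B(2)] card_mono[OF finite subset_UNIV, of X] card_basis[OF B(1)] by auto
    define k where "k = Suc (card X) - d"
    have k: "k \<in> {1..CARD('n) - d + 1}" "Suc (card X) = d + k" using X by (auto simp: k_def)
    let ?S = "{Y. Y \<in> spanning \<and> Suc (card Y) = d + k}"
    have "f k \<in> ideal_radical ?A"
      using k(1) by (intro subsetD[OF subset_ideal_radical] ring_module.span_base) auto
    then have 1: "p X * f k \<in> ideal_radical ?A" by (rule ring_module.subspace_scale[OF idl])
    have 2: "p X * p Y \<in> ideal_radical ?A" if Y: "Y \<in> ?S - {X}" for Y
    proof -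
      have "card Y = card X" "Y \<noteq> X" using Y k(2) by auto
      then have "\<not> Y \<subseteq> X" by (metis card_subset_eq finite)
      then have "X \<subset> X \<union> Y" by blast
      then have "card X < card (X \<union> Y)" by (intro psubset_card_mono) auto
      moreover have "card (X \<union> Y) \<le> CARD('n)" by (intro card_mono) auto
      ultimately have "CARD('n) - card (X \<union> Y) < CARD('n) - card X" by simp
      moreover have "X \<union> Y \<in> spanning" using less.prems unfolding spanning_def by blast
      ultimately have "p (X \<union> Y) \<in> ideal_radical ?A" by (rule less.hyps)
      then have "p (X \<inter> Y) * p (X \<union> Y) \<in> ideal_radical ?A" by (rule ring_module.subspace_scale[OF idl])
      then show ?thesis by (simp only: p_mult[of X Y])
    qed
    have "f k = p X + (\<Sum>Y\<in>?S - {X}. p Y)"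
      unfolding f_def using less.prems k(2) by (intro sum.remove) auto
    then have "p X * f k = p X ^ 2 + (\<Sum>Y\<in>?S - {X}. p X * p Y)"
      by (simp only: distrib_left sum_distrib_left power2_eq_square)
    then have "p X ^ 2 = p X * f k - (\<Sum>Y\<in>?S - {X}. p X * p Y)" by simp
    also have "\<dots> \<in> ideal_radical ?A"
      by (intro ring_module.subspace_diff[OF idl] ring_module.subspace_sum[OF idl] 1 2)
    finally show ?case by (rule ideal_radical_powerD)
  qed
  have "mono_poly ` sqf ` \<B> \<subseteq> ideal_radical ?A"
  proof safe
    fix B assume "B \<in> \<B>"
    then have "p B \<in> ideal_radical ?A" by (intro rad) (auto simp: spanning_def)
    then show "mono_poly (sqf B) \<in> ideal_radical ?A" by (simp add: p_def)
  qed
  then have "?I \<subseteq> ideal_radical ?A" using idl by (rule ring_module.span_minimal)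
  then have "ideal_radical ?I \<subseteq> ideal_radical ?A" by (rule ideal_radical_subset)
  then show ?thesis using le by blast
qed

theorem ara_basis_ideal: "ara (basis_ideal \<B> :: ('n, 'k::field) mpol set) = CARD('n) - d + 1"
  unfolding ara_def
proof (rule Least_equality)
  show "\<exists>f :: nat \<Rightarrow> ('n, 'k) mpol.
      ideal_radical (ideal_gen (f ` {1..CARD('n) - d + 1})) = ideal_radical (basis_ideal \<B>)"
    by (rule radical_generators_upper_bound)
  show "CARD('n) - d + 1 \<le> m"
    if "\<exists>f :: nat \<Rightarrow> ('n, 'k) mpol. ideal_radical (ideal_gen (f ` {1..m})) = ideal_radical (basis_ideal \<B>)"
    for m
    using that radical_generators_lower_bound by fastforce
qed

end

section \<open>Linear quotients\<close>

lemma var_poly_in_variable_ideal: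
  "var_poly i \<in> (ideal_gen (var_poly ` V) :: ('n::finite, 'k::field) mpol set) \<longleftrightarrow> i \<in> V"
proof -
  have eq: "(\<exists>w. Poly_Mapping.single i (1::nat) = w + Poly_Mapping.single j 1) \<longleftrightarrow> i = j" for i j :: 'n
  proof
    assume "\<exists>w. Poly_Mapping.single i (1::nat) = w + Poly_Mapping.single j 1"
    then obtain w where "Poly_Mapping.single i (1::nat) = w + Poly_Mapping.single j 1" by blast
    from arg_cong[OF this, of "\<lambda>u. Poly_Mapping.lookup u j"]
    show "i = j" by (auto simp: lookup_add lookup_single when_def split: if_splits)
  qed (auto intro: exI[of _ 0])
  have im: "(var_poly ` V :: ('n, 'k) mpol set) = mono_poly ` (\<lambda>j. Poly_Mapping.single j 1) ` V"
    by (simp only: image_image)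
  show ?thesis unfolding im mono_poly_in_ideal_iff by (simp only: bex_simps(7) eq) blast
qed

lemma num_gen_vars_variable_ideal:
  "num_gen_vars (ideal_gen (var_poly ` V) :: ('n::finite, 'k::field) mpol set) = card V"
  unfolding num_gen_vars_def
proof (rule Least_equality)
  fix m assume "\<exists>W. card W = m \<and> (ideal_gen (var_poly ` V) :: ('n, 'k) mpol set) = ideal_gen (var_poly ` W)"
  then obtain W where W: "card W = m" "(ideal_gen (var_poly ` V) :: ('n, 'k) mpol set) = ideal_gen (var_poly ` W)"
    by blast
  have "i \<in> V \<longleftrightarrow> i \<in> W" for i
    using var_poly_in_variable_ideal[of i V, where 'k = 'k] var_poly_in_variable_ideal[of i W, where 'k = 'k]
    by (simp only: W(2))
  then have "V = W" by (rule set_eqI)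
  then show "card V \<le> m" using W(1) by simp
qed (intro exI[of _ V] conjI refl)

lemma is_ideal_colon:
  assumes A: "is_ideal A"
  shows "is_ideal (ideal_colon A g)"
proof (rule ring_module.subspaceI)
  show "0 \<in> ideal_colon A g"
    using ring_module.subspace_0[OF A] by (simp add: ideal_colon_def)
  show "x + y \<in> ideal_colon A g" if "x \<in> ideal_colon A g" "y \<in> ideal_colon A g" for x y
    using ring_module.subspace_add[OF A, of "x * g" "y * g"] that
    by (simp add: ideal_colon_def distrib_right)
  show "c * x \<in> ideal_colon A g" if "x \<in> ideal_colon A g" for c x
  proof -
    have "x * g \<in> A" using that unfolding ideal_colon_def by blast
    then have "c * (x * g) \<in> A" by (rule ring_module.subspace_scale[OF A])
    then show ?thesis unfolding ideal_colon_def by (simp only: mem_Collect_eq mult.assoc)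
  qed
qed

lemma in_ideal_if_monomials:
  fixes f :: "('n, 'k::field) mpol"
  assumes "is_ideal A" "\<And>u. u \<in> Poly_Mapping.keys f \<Longrightarrow> mono_poly u \<in> A"
  shows "f \<in> A"
proof -
  have "Poly_Mapping.single u (Poly_Mapping.lookup f u) \<in> A" if "u \<in> Poly_Mapping.keys f" for u
    using ring_module.subspace_scale[OF assms(1) assms(2)[OF that], of "Poly_Mapping.single 0 (Poly_Mapping.lookup f u)"]
    by (simp add: mult_single)
  then have "(\<Sum>u\<in>Poly_Mapping.keys f. Poly_Mapping.single u (Poly_Mapping.lookup f u)) \<in> A"
    by (intro ring_module.subspace_sum[OF assms(1)])
  then show ?thesis by (simp only: poly_mapping_single_sum)
qed

lemma keys_mult_mono_poly:
  fixes f :: "('n, 'k::field) mpol"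
  assumes "u \<in> Poly_Mapping.keys f"
  shows "u + w \<in> Poly_Mapping.keys (f * mono_poly w)"
proof -
  have "f * mono_poly w = (\<Sum>v\<in>Poly_Mapping.keys f. Poly_Mapping.single (v + w) (Poly_Mapping.lookup f v))"
    unfolding sum_distrib_right[symmetric]
    by (subst (1) poly_mapping_single_sum[of f, symmetric]) (simp add: sum_distrib_right mult_single)
  then have "Poly_Mapping.lookup (f * mono_poly w) (u + w)
      = (\<Sum>v\<in>Poly_Mapping.keys f. if v = u then Poly_Mapping.lookup f v else 0)"
    by (simp add: lookup_sum lookup_single when_def)
  also have "\<dots> \<noteq> 0" using assms by (simp add: in_keys_iff)
  finally show ?thesis by (simp add: in_keys_iff)
qed

context loopless_matroid
begin

text \<open>Distinct bases have the same number of elements, so \<open>x\<^sub>i x\<^sub>B\<close> with \<open>i \<in> B\<close> is divisible by no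
generator other than \<open>x\<^sub>B\<close> itself.\<close>

lemma var_poly_in_lq_colon_iff:
  assumes us: "distinct us" "set us \<subseteq> sqf ` \<B>" "j < length us" "us ! j = sqf B"
  shows "var_poly i \<in> (lq_colon us j :: ('n, 'k::field) mpol set) \<longleftrightarrow>
    i \<notin> B \<and> (\<exists>B'. sqf B' \<in> set (take j us) \<and> B' \<subseteq> insert i B)"
proof -
  have B: "B \<in> \<B>" using us nth_mem[OF us(3)] by auto
  have new: "us ! j \<notin> set (take j us)"
    using us(1,3) by (auto simp: in_set_conv_nth nth_eq_iff_index_eq)
  have "var_poly i \<in> (lq_colon us j :: ('n, 'k) mpol set) \<longleftrightarrow>
      (\<exists>v\<in>set (take j us). \<exists>w. Poly_Mapping.single i 1 + sqf B = w + v)"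
    by (simp add: lq_colon_def ideal_colon_def us(4) mult_single mono_poly_in_ideal_iff)
  also have "\<dots> \<longleftrightarrow> i \<notin> B \<and> (\<exists>B'. sqf B' \<in> set (take j us) \<and> B' \<subseteq> insert i B)"
  proof
    assume "\<exists>v\<in>set (take j us). \<exists>w. Poly_Mapping.single i 1 + sqf B = w + v"
    then obtain v w where v: "v \<in> set (take j us)" "Poly_Mapping.single i 1 + sqf B = w + v" by blast
    then obtain B' where B': "v = sqf B'" "B' \<in> \<B>" using us(2) set_take_subset[of j us] by blast
    have sub: "B' \<subseteq> insert i B"
    proof
      fix x assume "x \<in> B'"
      then show "x \<in> insert i B"
        using arg_cong[OF v(2), of "\<lambda>u. Poly_Mapping.lookup u x"]
        by (auto simp: B'(1) lookup_add lookup_single when_def split: if_splits)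
    qed
    moreover have "i \<notin> B"
    proof
      assume "i \<in> B"
      then have "B' = B" using sub B' B basis_subset_eq by (simp add: insert_absorb)
      then show False using new v B' us(4) by simp
    qed
    ultimately show "i \<notin> B \<and> (\<exists>B'. sqf B' \<in> set (take j us) \<and> B' \<subseteq> insert i B)"
      using v(1) B'(1) by blast
  next
    assume "i \<notin> B \<and> (\<exists>B'. sqf B' \<in> set (take j us) \<and> B' \<subseteq> insert i B)"
    then obtain B' where B': "i \<notin> B" "sqf B' \<in> set (take j us)" "B' \<subseteq> insert i B" by blast
    have "Poly_Mapping.single i 1 + sqf B = sqf (insert i B)"
      using B'(1) by (intro poly_mapping_eqI) (auto simp: lookup_add lookup_single when_def)
    then show "\<exists>v\<in>set (take j us). \<exists>w. Poly_Mapping.single i 1 + sqf B = w + v"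
      using B'(2) sqf_dvd_iff[of "insert i B" B'] B'(3) by auto
  qed
  finally show ?thesis .
qed

text \<open>The value is the same for every ordering: no colon ideal contains a variable of the current basis, and the
last one contains all other variables. An ordering with a single generator is covered too, since
absence of loops then forces \<open>n = d\<close>.\<close>

lemma q_ordering_eq:
  assumes min: "min_gens I = sqf ` \<B>" and lq: "linear_quotient_ordering I us"
  shows "q_ordering (I :: ('n, 'k::field) mpol set) us = CARD('n) - d"
proof -
  have us: "distinct us" "set us = sqf ` \<B>"
    and ex: "\<And>j. j \<in> {1..<length us} \<Longrightarrow> \<exists>V. (lq_colon us j :: ('n, 'k) mpol set) = ideal_gen (var_poly ` V)"
    using lq min by (auto simp: linear_quotient_ordering_def)
  let ?q = "\<lambda>j. num_gen_vars (lq_colon us j :: ('n, 'k) mpol set)"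
  have co: "card (- B) = CARD('n) - d" if "B \<in> \<B>" for B
    using card_basis[OF that] by (simp add: Compl_eq_Diff_UNIV card_Diff_subset)
  have q: "\<exists>V. ?q j = card V \<and> (\<forall>i. i \<in> V \<longleftrightarrow> i \<notin> B \<and> (\<exists>B'. sqf B' \<in> set (take j us) \<and> B' \<subseteq> insert i B))"
    if j: "j \<in> {1..<length us}" and jB: "us ! j = sqf B" for j B
  proof -
    obtain V where V: "(lq_colon us j :: ('n, 'k) mpol set) = ideal_gen (var_poly ` V)" using ex[OF j] by blast
    have "i \<in> V \<longleftrightarrow> i \<notin> B \<and> (\<exists>B'. sqf B' \<in> set (take j us) \<and> B' \<subseteq> insert i B)" for i
      using var_poly_in_lq_colon_iff[of us j B i, where 'k = 'k] us j jB unfolding V var_poly_in_variable_ideal by simp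
    then show ?thesis unfolding V num_gen_vars_variable_ideal by blast
  qed
  have le: "?q j \<le> CARD('n) - d" if j: "j \<in> {1..<length us}" for j
  proof -
    have "us ! j \<in> sqf ` \<B>" using us(2) nth_mem[of j us] j by simp
    then obtain B where B: "B \<in> \<B>" "us ! j = sqf B" by blast
    obtain V where V: "?q j = card V" "V \<subseteq> - B" using q[OF j B(2)] by blast
    show ?thesis using V card_mono[OF finite V(2)] co[OF B(1)] by simp
  qed
  let ?l = "length us - 1"
  have nonempty: "us \<noteq> []" using us(2) basis_exists by auto
  then have "us ! ?l \<in> sqf ` \<B>" using us(2) nth_mem[of ?l us] by simp
  then obtain B where B: "B \<in> \<B>" "us ! ?l = sqf B" by blast
  have before: "sqf B' \<in> set (take ?l us)" if B': "B' \<in> \<B>" "B' \<noteq> B" for B'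
  proof -
    have "sqf B' \<in> set us" using us(2) B'(1) by simp
    then obtain k where k: "k < length us" "us ! k = sqf B'" by (auto simp: in_set_conv_nth)
    then have "k \<noteq> ?l" using B(2) B'(2) by auto
    then have "k < ?l" using k(1) by simp
    then show ?thesis using k by (auto simp: in_set_conv_nth)
  qed
  have all: "\<exists>B'. sqf B' \<in> set (take ?l us) \<and> B' \<subseteq> insert i B" if "i \<notin> B" for i
  proof -
    obtain b where b: "b \<in> B" "insert i (B - {b}) \<in> \<B>" using insert_element[OF B(1) \<open>i \<notin> B\<close>] by blast
    then show ?thesis using before[OF b(2)] that by blast
  qed
  have "Max (insert 0 (?q ` {1..<length us})) = CARD('n) - d"
  proof (rule Max_eqI)
    show "x \<le> CARD('n) - d" if "x \<in> insert 0 (?q ` {1..<length us})" for x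
      using that le by auto
    show "CARD('n) - d \<in> insert 0 (?q ` {1..<length us})"
    proof (cases "length us = 1")
      case True
      then have "- B = {}" using all by fastforce
      then have "CARD('n) - d = 0" using co[OF B(1)] by simp
      then show ?thesis by simp
    next
      case False
      then have l: "?l \<in> {1..<length us}" using nonempty by (cases "length us") auto
      obtain V where V: "?q ?l = card V" "\<And>i. i \<in> V \<longleftrightarrow> i \<notin> B" using q[OF l B(2)] all by blast
      have "V = - B" using V(2) by blast
      then have "?q ?l = CARD('n) - d" using V(1) co[OF B(1)] by simp
      then show ?thesis using l by (metis imageI insertI2)
    qed
  qed simp
  then show ?thesis by (simp add: q_ordering_def)
qed

text \<open>The binary weight compares two bases at the largest place where they differ, and the larger weight
owns that place \<open>i\<close>. Swapping \<open>i\<close> into \<open>B\<close> against an element of \<open>B - A\<close> raises the weight,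
because that element comes before \<open>i\<close>.\<close>

lemma lex_exchange:
  fixes e :: "'n \<Rightarrow> nat"
  assumes e: "inj e" and B: "A \<in> \<B>" "B \<in> \<B>"
    and less: "set_encode (e ` B) < set_encode (e ` A)"
  shows "\<exists>i\<in>A. \<exists>b\<in>B. i \<notin> B \<and> insert i (B - {b}) \<in> \<B> \<and>
    set_encode (e ` B) < set_encode (e ` insert i (B - {b}))"
proof -
  let ?w = "\<lambda>X. \<Sum>x\<in>X. (2::nat) ^ e x"
  have w: "set_encode (e ` X) = ?w X" for X
    unfolding set_encode_def using e by (subst sum.reindex) (auto simp: inj_on_def dest: injD)
  have split: "?w X = ?w (X \<inter> Y) + ?w (X - Y)" for X Y
    by (rule sum.Int_Diff) simp
  have diff: "?w (B - A) < ?w (A - B)"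
    using less split[of A B] split[of B A] unfolding w by (simp add: Int_commute)
  then have "A - B \<noteq> {}" by (metis sum.empty not_less0)
  then have "Max (e ` (A - B)) \<in> e ` (A - B)" by (intro Max_in) auto
  then obtain i where i: "Max (e ` (A - B)) = e i" "i \<in> A - B" by (rule imageE)
  have max: "e x \<le> e i" if "x \<in> A - B" for x
    unfolding i(1)[symmetric] using that by (intro Max_ge) auto
  have small: "e x < e i" if x: "x \<in> B - A" for x
  proof (rule ccontr)
    assume "\<not> e x < e i"
    moreover have "e x \<noteq> e i" using x i(2) e by (auto dest: injD)
    ultimately have lt: "e i < e x" by simp
    have "?w (A - B) = (\<Sum>k\<in>e ` (A - B). 2 ^ k)"
      using e by (subst sum.reindex) (auto simp: inj_on_def dest: injD)
    also have "\<dots> \<le> (\<Sum>k<e x. 2 ^ k)"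
      using max lt by (intro sum_mono2) (auto intro: le_less_trans)
    also have "\<dots> < 2 ^ e x" by (simp add: mask_eq_sum_exp_nat[symmetric] lessThan_def)
    also have "(2::nat) ^ e x \<le> ?w (B - A)" using x by (intro member_le_sum) auto
    finally show False using diff by simp
  qed
  obtain b where b: "b \<in> B" "b \<notin> A" "insert i (B - {b}) \<in> \<B>"
    using exchange_into[OF B, of i] i(2) by blast
  have "e b < e i" by (rule small) (use b in auto)
  then have "(2::nat) ^ e b < 2 ^ e i" by simp
  moreover have "?w B = 2 ^ e b + ?w (B - {b})" using b by (intro sum.remove) auto
  moreover have "?w (insert i (B - {b})) = 2 ^ e i + ?w (B - {b})" using i(2) by (intro sum.insert) auto
  ultimately have "?w B < ?w (insert i (B - {b}))" by simp
  then show ?thesis unfolding w using i(2) b by blast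
qed

text \<open>Order the bases by decreasing binary weight. If \<open>u x\<^sub>B\<close> is divisible by an earlier \<open>x\<^sub>A\<close>, then
\<open>lex_exchange\<close> gives \<open>i \<in> A - B\<close> such that \<open>x\<^sub>i\<close> divides \<open>u\<close> and already lies in the colon
ideal.\<close>

lemma linear_quotient_ordering_exists:
  assumes min: "min_gens I = sqf ` \<B>"
  shows "\<exists>us. linear_quotient_ordering (I :: ('n, 'k::field) mpol set) us"
proof -
  obtain e :: "'n \<Rightarrow> nat" where e: "inj e"
    using finite_imp_inj_to_nat_seg[OF finite, of "UNIV :: 'n set"] by auto
  define key where "key u = - int (set_encode (e ` Poly_Mapping.keys u))" for u :: "'n mon"
  obtain us0 where us0: "set us0 = sqf ` \<B>" "distinct us0"
    using finite_distinct_list[of "sqf ` \<B>"] by auto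
  define us where "us = sort_key key us0"
  have us: "set us = sqf ` \<B>" "distinct us" "sorted (map key us)"
    using us0 by (simp_all add: us_def)
  have "\<exists>V. (lq_colon us j :: ('n, 'k) mpol set) = ideal_gen (var_poly ` V)" if j: "j < length us" for j
  proof -
    have "us ! j \<in> sqf ` \<B>" using us(1) nth_mem[OF j] by simp
    then obtain B where B: "B \<in> \<B>" "us ! j = sqf B" by blast
    have earlier: "sqf B' \<in> set (take j us)" if B': "B' \<in> \<B>" "key (sqf B') < key (sqf B)" for B'
    proof -
      have "sqf B' \<in> set us" using us(1) B'(1) by simp
      then obtain k where k: "k < length us" "us ! k = sqf B'" by (auto simp: in_set_conv_nth)
      have "k < j"
      proof (rule ccontr)
        assume "\<not> k < j"
        then have "key (us ! j) \<le> key (us ! k)"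
          using sorted_nth_mono[OF us(3), of j k] k(1) by simp
        then show False using B'(2) k(2) B(2) by simp
      qed
      then show ?thesis using k j by (auto simp: in_set_conv_nth)
    qed
    define L where "L = (lq_colon us j :: ('n, 'k) mpol set)"
    define V where "V = {i. var_poly i \<in> L}"
    have idl: "is_ideal L" unfolding L_def lq_colon_def by (intro is_ideal_colon) simp
    have "L \<subseteq> ideal_gen (var_poly ` V)"
    proof
      fix f assume f: "f \<in> L"
      show "f \<in> ideal_gen (var_poly ` V)"
      proof (rule in_ideal_if_monomials)
        fix u assume "u \<in> Poly_Mapping.keys f"
        then have "u + sqf B \<in> Poly_Mapping.keys (f * mono_poly (sqf B))" by (rule keys_mult_mono_poly)
        moreover have "f * mono_poly (sqf B) \<in> ideal_gen (mono_poly ` set (take j us))"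
          using f by (simp add: L_def lq_colon_def ideal_colon_def B(2))
        ultimately obtain v w where v: "v \<in> set (take j us)" "u + sqf B = w + v"
          using keys_mono_poly_ideal by blast
        then obtain k where k: "k < j" "us ! k = v" using j by (auto simp: in_set_conv_nth)
        have "v \<in> set us" using v(1) by (rule in_set_takeD)
        then obtain A where A: "A \<in> \<B>" "v = sqf A" using us(1) by auto
        have "us ! k \<noteq> us ! j" using k(1) j us(2) by (simp add: nth_eq_iff_index_eq)
        then have "A \<noteq> B" using k(2) A(2) B(2) by auto
        have "key (sqf A) \<le> key (sqf B)"
          using sorted_nth_mono[OF us(3), of k j] k j A(2) B(2) by simp
        moreover have "set_encode (e ` A) \<noteq> set_encode (e ` B)"
          using \<open>A \<noteq> B\<close> e by (simp add: set_encode_eq inj_image_eq_iff)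
        ultimately have "set_encode (e ` B) < set_encode (e ` A)"
          by (simp add: key_def)
        then obtain i b where ib: "i \<in> A" "i \<notin> B" "insert i (B - {b}) \<in> \<B>"
            "set_encode (e ` B) < set_encode (e ` insert i (B - {b}))"
          using lex_exchange[OF e A(1) B(1)] by blast
        have "sqf (insert i (B - {b})) \<in> set (take j us)"
          by (rule earlier[OF ib(3)]) (use ib(4) in \<open>simp only: key_def keys_sqf neg_less_iff_less of_nat_less_iff\<close>)
        then have "var_poly i \<in> L"
          unfolding L_def using var_poly_in_lq_colon_iff[of us j B i, where 'k = 'k] us j B ib(2) by blast
        then have V: "i \<in> V" by (simp add: V_def)
        have "Poly_Mapping.lookup u i \<noteq> 0"
          using arg_cong[OF v(2), of "\<lambda>u. Poly_Mapping.lookup u i"] ib(1,2) A(2) by (auto simp: lookup_add)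
        then have "u = (u - Poly_Mapping.single i 1) + Poly_Mapping.single i 1"
          by (intro poly_mapping_eqI) (auto simp: lookup_add lookup_minus lookup_single when_def)
        then have "mono_poly u = mono_poly (u - Poly_Mapping.single i 1) * (var_poly i :: ('n, 'k) mpol)"
          by (simp add: mult_single)
        then show "mono_poly u \<in> (ideal_gen (var_poly ` V) :: ('n, 'k) mpol set)"
          using V by (auto intro: ring_module.span_scale ring_module.span_base)
      qed simp
    qed
    moreover have "ideal_gen (var_poly ` V) \<subseteq> L"
      using idl by (intro ring_module.span_minimal) (auto simp: V_def)
    ultimately show ?thesis unfolding L_def by blast
  qed
  moreover have "sorted (map mon_deg us)"
  proof -
    have "map mon_deg us = map (\<lambda>_. d) us" using us(1) card_basis by (intro map_cong) auto
    then show ?thesis by (simp add: map_replicate_const)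
  qed
  ultimately have "linear_quotient_ordering I us"
    unfolding linear_quotient_ordering_def min using us by auto
  then show ?thesis ..
qed

lemma q_inv_eq:
  assumes "min_gens I = sqf ` \<B>"
  shows "q_inv (I :: ('n, 'k::field) mpol set) = CARD('n) - d"
  unfolding q_inv_def
proof (rule the_equality)
  show "\<exists>us. linear_quotient_ordering I us \<and> CARD('n) - d = q_ordering I us"
    using linear_quotient_ordering_exists[OF assms] q_ordering_eq[OF assms] by auto
  show "q = CARD('n) - d" if "\<exists>us. linear_quotient_ordering I us \<and> q = q_ordering I us" for q
    using that q_ordering_eq[OF assms] by auto
qed

end

section \<open>Matroidal ideals\<close>

lemma is_min_gens_min_gens:
  fixes I :: "('n::finite, 'k::field) mpol set"
  assumes "monomial_ideal I"
  shows "is_min_gens I (min_gens I)"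
  unfolding min_gens_def by (rule theI'[OF ex1_min_gens[OF assms]])

lemma matroidal_loopless_matroid:
  fixes I :: "('n::finite, 'k::field) mpol set"
  assumes I: "matroidal I" "has_degree I d" "ideal_supp I = UNIV"
  shows "loopless_matroid (Poly_Mapping.keys ` min_gens I) d"
    and "min_gens I = sqf ` Poly_Mapping.keys ` min_gens I"
proof -
  have sqf: "sqf (Poly_Mapping.keys u) = u" if "u \<in> min_gens I" for u
    using I(1) that by (intro sqf_keys) (simp add: matroidal_def)
  show min: "min_gens I = sqf ` Poly_Mapping.keys ` min_gens I"
    using sqf by (auto simp: image_image)
  let ?\<B> = "Poly_Mapping.keys ` min_gens I"
  have mem: "sqf A \<in> min_gens I \<longleftrightarrow> A \<in> ?\<B>" for A
    using sqf by (metis imageE image_eqI keys_sqf)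
  show "loopless_matroid ?\<B> d"
  proof
    show "card B = d" if "B \<in> ?\<B>" for B
      using I(2) mem[of B] that by (metis has_degree_def mon_deg_sqf)
    show "\<Union>?\<B> = UNIV" using I(3) by (simp add: ideal_supp_def)
    show "\<exists>j. j \<in> Y \<and> j \<notin> X \<and> insert j (X - {i}) \<in> ?\<B>"
      if X: "X \<in> ?\<B>" and Y: "Y \<in> ?\<B>" and i: "i \<in> X" "i \<notin> Y" for X Y i
    proof -
      have "Poly_Mapping.lookup (sqf Y) i < Poly_Mapping.lookup (sqf X) i" using i by simp
      then obtain j where j: "Poly_Mapping.lookup (sqf X) j < Poly_Mapping.lookup (sqf Y) j"
          "Poly_Mapping.single j 1 + sqf X - Poly_Mapping.single i 1 \<in> min_gens I"
        using I(1) X Y unfolding matroidal_def mem[symmetric] by blast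
      then have jXY: "j \<in> Y" "j \<notin> X" by (auto split: if_splits)
      have "Poly_Mapping.single j 1 + sqf X - Poly_Mapping.single i 1 = sqf (insert j (X - {i}))"
        using jXY i by (intro poly_mapping_eqI) (auto simp: lookup_add lookup_minus lookup_single when_def)
      then show ?thesis using j(2) jXY mem by auto
    qed
  qed
qed

theorem theorem4p4:
  fixes I :: "('n::finite, 'k::field) mpol set" and d :: nat and h :: enat
  assumes "matroidal I"
    and "has_degree I d"
    and "ideal_supp I = UNIV"
    and "h = ideal_height I"
    and "I = squarefree_veronese d \<or>
         (\<exists>J. I = ideal_product d J \<and>
              (\<forall>i\<in>{1..d}. \<exists>V. enat (card V) = h \<and> J i = ideal_gen (var_poly ` V))) \<or>
         d = 2"
  shows "ara I = q_inv I + 1"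
proof -
  interpret loopless_matroid "Poly_Mapping.keys ` min_gens I" d
    using matroidal_loopless_matroid(1) assms(1-3) .
  have min: "min_gens I = sqf ` Poly_Mapping.keys ` min_gens I"
    using matroidal_loopless_matroid(2) assms(1-3) .
  have "monomial_ideal I" using assms(1) by (simp add: matroidal_def)
  then have "I = ideal_gen (mono_poly ` min_gens I)"
    using is_min_gens_min_gens by (auto simp: is_min_gens_def)
  then have "I = basis_ideal (Poly_Mapping.keys ` min_gens I)" using min by simp
  then have "ara I = CARD('n) - d + 1" using ara_basis_ideal by metis
  then show ?thesis using q_inv_eq[OF min] by simp
qed

end
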